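(* Let $G=\mathrm{SL}_{2\ell+1}$ over $\mathbb{C}$ ($\ell\ge1$) and let $\sigma$ be its diagram automorphism of order $2$ (type $(A_{2\ell},2)$). Then $\pi$ maps $\mathcal{M}$ isomorphically onto $\mathcal{N}_{\mathfrak p,2}$. Moreover, for each $0\le j\le\ell$, $\pi$ maps $\mathcal{M}_{(1^j0^{\ell-j})}$ isomorphically onto the nilpotent orbit $[2^j1^{2\ell-2j+1}]$.
   Context: $\sigma(A)=JA^{-T}J^{-1}$ on $G$, where $J$ is the antidiagonal $(2\ell+1)\times(2\ell+1)$ matrix with entries $J_{i,2\ell+2-i}=(-1)^{i-1}$ (the matrix of a nondegenerate symmetric form). $\mathfrak p=\{A\in\mathfrak{sl}_{2\ell+1}: A=JA^TJ^{-1}\}$ is the $(-1)$-eigenspace of $\sigma$ on $\mathfrak{sl}_{2\ell+1}$, $K=G^\sigma\cong\mathrm{SO}_{2\ell+1}$ acts on $\mathfrak p$ by conjugation, $\mathcal{N}_{\mathfrak p}$ is the set of nilpotent elements of $\mathfrak p$, and $\mathcal{N}_{\mathfrak p,2}=\{x\in\mathcal{N}_{\mathfrak p}: x^2=0\}$. $[2^j1^{2\ell-2j+1}]$ is the $K$-orbit of nilpotent elements of $\mathfrak p$ with $j$ Jordan blocks of size $2$ and the rest of size $1$. $\mathcal{O}=\mathbb{C}[[t]]$, $\mathcal{K}=\mathbb{C}((t))$, $\mathcal{O}^-=\mathbb{C}[t^{-1}]$, with $\sigma(t)=-t$, $\sigma|_{\mathbb C}=\mathrm{Id}$; $\sigma$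 acts on $G(\mathcal K)$ etc. through both $G$ and $t$. $\mathcal{G}r=G(\mathcal{K})^\sigma/G(\mathcal{O})^\sigma$ with base point $e_0$. Let $T$ be the diagonal torus. $X_*(T)_\sigma=X_*(T)/(\mathrm{Id}-\sigma)X_*(T)$ is identified with $\mathbb{Z}^\ell$ by sending the class $\bar\lambda$ of $\lambda=(b_1,\dots,b_{2\ell+1})$, $\sum b_i=0$, to $(a_1,\dots,a_\ell)$, $a_i=b_i-b_{2\ell+2-i}$ (so the images of the simple coroots $\check\alpha_1,\dots,\check\alpha_\ell$ become the standard simple roots $e_i-e_{i+1}$ $(i<\ell)$ and $e_\ell$ of type $B_\ell$). Put $n^\lambda=t^\lambda\sigma(t^\lambda)$ and, for $a_1\ge\dots\ge a_\ell\ge0$, $\mathcal{G}r_{\bar\lambda}=G(\mathcal{O})^\sigma n^\lambda\cdot e_0$. $\mathcal{G}r_0^-=G(\mathcal{O}^-)^\sigma\cdot e_0\simeq G(\mathcal{O}^-)_0^\sigma$, where $G(\mathcal{O}^-)_0$ is the kernel of evaluation at $t=\infty$; $\mathcal{M}_{\bar\lambda}=\mathcal{G}r_{\bar\lambda}\cap\mathcal{G}r_0^-$. A dominant weight is small if it is not $\succeq2\gamma_0$, where $\gamma_0=(1,0,\dots,0)$ is the highest short root of type $B_\ell$ and $\succeq$ is the dominance order; the small dominant weights are $(1^j0^{\ell-j})$ ($j$ ones followed by zeros), $0\le j\le\ell$. $\mathcal{M}=\bigcup_{\bar\lambda\text{ small}}\mathcal{M}_{\bar\lambda}$, an open subset of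 the (reduced) twisted Schubert variety $\overline{\mathcal{G}r}_{(1^\ell)}$. All spaces are regarded as varieties (reduced). $\pi:\mathcal{G}r_0^-\simeq G(\mathcal{O}^-)_0^\sigma\to\mathfrak p$ sends $I+xt^{-1}+(\text{terms in }t^{-2},t^{-3},\dots)$ to $x$. *)

theory Defs
  imports
    Complex_Main
    "HOL-Computational_Algebra.Formal_Laurent_Series"
    "Jordan_Normal_Form.Gauss_Jordan_Elimination"
    "Jordan_Normal_Form.Jordan_Normal_Form"
begin

text \<open>Rows, columns and coordinates are numbered from 0, so the index involution
  \<open>i \<mapsto> 2 l + 2 - i\<close> on \<open>{1, \<dots>, 2 l + 1}\<close> reads \<open>i \<mapsto> 2 l - i\<close> here.\<close>

section \<open>The group and its diagram automorphism\<close>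

definition SL :: "nat \<Rightarrow> 'a::field mat set" where
  "SL n = {A \<in> carrier_mat n n. det A = 1}"

definition minv :: "'a::field mat \<Rightarrow> 'a mat" where
  "minv A = the (mat_inverse A)"

definition Jmat :: "nat \<Rightarrow> 'a::field mat" where
  "Jmat l = mat (2*l+1) (2*l+1) (\<lambda>(i,j). if i + j = 2*l then (-1)^i else 0)"

definition theta :: "nat \<Rightarrow> 'a::field mat \<Rightarrow> 'a mat" where
  "theta l A = Jmat l * transpose_mat (minv A) * minv (Jmat l)"

definition Kgrp :: "nat \<Rightarrow> complex mat set" where
  "Kgrp l = {A \<in> SL (2*l+1). theta l A = A}"

section \<open>The symmetric space and its nilpotent orbits\<close>

definition sl :: "nat \<Rightarrow> complex mat set" where
  "sl n = {x \<in> carrier_mat n n. (\<Sum>i<n. x $$ (i,i)) = 0}"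

definition pspace :: "nat \<Rightarrow> complex mat set" where
  "pspace l = {x \<in> sl (2*l+1). x = Jmat l * transpose_mat x * minv (Jmat l)}"

definition Np :: "nat \<Rightarrow> complex mat set" where
  "Np l = {x \<in> pspace l. \<exists>k. x ^\<^sub>m k = 0\<^sub>m (2*l+1) (2*l+1)}"

definition Np2 :: "nat \<Rightarrow> complex mat set" where
  "Np2 l = {x \<in> Np l. x * x = 0\<^sub>m (2*l+1) (2*l+1)}"

definition K_orbit :: "nat \<Rightarrow> complex mat \<Rightarrow> complex mat set" where
  "K_orbit l x = {k * x * minv k | k. k \<in> Kgrp l}"

text \<open>\<open>nilp_type l j\<close> is the set \<open>[2^j 1^(2l-2j+1)]\<close>, meant for \<open>j \<le> l\<close>.\<close>

definition nilp_type :: "nat \<Rightarrow> nat \<Rightarrow> complex mat set" where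
  "nilp_type l j =
     {x \<in> Np l. jordan_nf x (replicate j (2,0) @ replicate (2*l+1-2*j) (1,0))}"

section \<open>The twisted affine Grassmannian\<close>

definition fls_O :: "complex fls set" where
  "fls_O = {f. \<forall>k<0. fls_nth f k = 0}"

text \<open>A Laurent series has only finitely many terms of negative degree, so this is
  \<open>\<complex>[t\<^sup>-\<^sup>1]\<close>.\<close>

definition fls_O_minus :: "complex fls set" where
  "fls_O_minus = {f. \<forall>k>0. fls_nth f k = 0}"

definition sigma :: "nat \<Rightarrow> complex fls mat \<Rightarrow> complex fls mat" where
  "sigma l A = theta l (map_mat (\<lambda>f. fls_compose_fps f (- fps_X)) A)"

text \<open>\<open>G_sigma l S\<close> is \<open>G(S)\<^sup>\<sigma>\<close> for a \<open>\<sigma>\<close>-stable subring \<open>S\<close> of \<open>\<complex>((t))\<close>.\<close>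

definition G_sigma :: "nat \<Rightarrow> complex fls set \<Rightarrow> complex fls mat set" where
  "G_sigma l S = {A \<in> SL (2*l+1). elements_mat A \<subseteq> S \<and> sigma l A = A}"

definition G_O_minus_0 :: "nat \<Rightarrow> complex fls mat set" where
  "G_O_minus_0 l = {A \<in> G_sigma l fls_O_minus.
     map_mat (\<lambda>f. fls_nth f 0) A = 1\<^sub>m (2*l+1)}"

text \<open>Points of \<open>Gr\<close> are left cosets of \<open>G(\<O>)\<^sup>\<sigma>\<close>.\<close>

definition act :: "complex fls mat \<Rightarrow> complex fls mat set \<Rightarrow> complex fls mat set" where
  "act g c = (\<lambda>h. g * h) ` c"

definition e0 :: "nat \<Rightarrow> complex fls mat set" where
  "e0 l = G_sigma l fls_O"

definition Gr :: "nat \<Rightarrow> complex fls mat set set" where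
  "Gr l = {act g (e0 l) | g. g \<in> G_sigma l UNIV}"

definition Gr_minus_0 :: "nat \<Rightarrow> complex fls mat set set" where
  "Gr_minus_0 l = {act g (e0 l) | g. g \<in> G_sigma l fls_O_minus}"

definition cochars :: "nat \<Rightarrow> int vec set" where
  "cochars l = {b \<in> carrier_vec (2*l+1). (\<Sum>i<2*l+1. b $ i) = 0}"

text \<open>The class of a cocharacter in \<open>X\<^sub>*(T)\<^sub>\<sigma>\<close>, identified with \<open>\<int>\<^sup>l\<close>.\<close>

definition cls :: "nat \<Rightarrow> int vec \<Rightarrow> int vec" where
  "cls l b = vec l (\<lambda>i. b $ i - b $ (2*l - i))"

definition tpow :: "nat \<Rightarrow> int vec \<Rightarrow> complex fls mat" where
  "tpow l b = mat (2*l+1) (2*l+1) (\<lambda>(i,j). if i = j then fls_X_intpow (b $ i) else 0)"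

definition npow :: "nat \<Rightarrow> int vec \<Rightarrow> complex fls mat" where
  "npow l b = tpow l b * sigma l (tpow l b)"

definition Gr_cell :: "nat \<Rightarrow> int vec \<Rightarrow> complex fls mat set set" where
  "Gr_cell l b = {act g (act (npow l b) (e0 l)) | g. g \<in> G_sigma l fls_O}"

definition M_cell :: "nat \<Rightarrow> int vec \<Rightarrow> complex fls mat set set" where
  "M_cell l b = Gr_cell l b \<inter> Gr_minus_0 l"

section \<open>Small dominant weights of type \<open>B\<^sub>l\<close>\<close>

definition dominant :: "nat \<Rightarrow> int vec \<Rightarrow> bool" where
  "dominant l a \<longleftrightarrow> a \<in> carrier_vec l \<and> (\<forall>i<l. a $ i \<ge> 0) \<and>
     (\<forall>i. i + 1 < l \<longrightarrow> a $ i \<ge> a $ (i + 1))"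

definition simple_root :: "nat \<Rightarrow> nat \<Rightarrow> int vec" where
  "simple_root l k = (if k + 1 < l then unit_vec l k - unit_vec l (k + 1) else unit_vec l k)"

definition dominates :: "nat \<Rightarrow> int vec \<Rightarrow> int vec \<Rightarrow> bool" where
  "dominates l a c \<longleftrightarrow>
     (\<exists>m :: nat \<Rightarrow> nat. \<forall>i<l. a $ i - c $ i = (\<Sum>k<l. int (m k) * simple_root l k $ i))"

definition gamma0 :: "nat \<Rightarrow> int vec" where
  "gamma0 l = unit_vec l 0"

definition small :: "nat \<Rightarrow> int vec \<Rightarrow> bool" where
  "small l a \<longleftrightarrow> dominant l a \<and> \<not> dominates l a (2 \<cdot>\<^sub>v gamma0 l)"

definition M_small :: "nat \<Rightarrow> complex fls mat set set" where
  "M_small l = \<Union> (M_cell l ` {b \<in> cochars l. small l (cls l b)})"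

section \<open>The map \<open>\<pi>\<close>\<close>

text \<open>The identification of \<open>Gr\<^sub>0\<^sup>-\<close> with \<open>G(\<O>\<^sup>-)\<^sub>0\<^sup>\<sigma>\<close>: the representative is unique
  because a matrix in both \<open>G(\<O>\<^sup>-)\<^sub>0\<close> and \<open>G(\<O>)\<close> is the identity.\<close>

definition rep :: "nat \<Rightarrow> complex fls mat set \<Rightarrow> complex fls mat" where
  "rep l c = (THE A. A \<in> G_O_minus_0 l \<and> act A (e0 l) = c)"

definition pi_map :: "nat \<Rightarrow> complex fls mat set \<Rightarrow> complex mat" where
  "pi_map l c = map_mat (\<lambda>f. fls_nth f (-1)) (rep l c)"

section \<open>Regular functions and isomorphisms\<close>

text \<open>A variety is given by a set of points \<open>X\<close> inside an affine (ind-)space, which is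
  described by its coordinate functions \<open>C\<close>. \<open>polys C\<close> is the set of polynomials in finitely many of
  these, \<open>regular_on C X\<close> the set of regular functions on \<open>X\<close> with its reduced
  structure: functions that are, Zariski locally on \<open>X\<close>, quotients of polynomials. This is the
  usual notion when \<open>X\<close> is locally closed in the space spanned by finitely many coordinates.\<close>

inductive_set polys :: "('a \<Rightarrow> complex) set \<Rightarrow> ('a \<Rightarrow> complex) set"
  for C :: "('a \<Rightarrow> complex) set" where
  const: "(\<lambda>x. c) \<in> polys C"
| coord: "f \<in> C \<Longrightarrow> f \<in> polys C"
| add: "f \<in> polys C \<Longrightarrow> g \<in> polys C \<Longrightarrow> (\<lambda>x. f x + g x) \<in> polys C"
| mult: "f \<in> polys C \<Longrightarrow> g \<in> polys C \<Longrightarrow> (\<lambda>x. f x * g x) \<in> polys C"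

definition regular_on :: "('a \<Rightarrow> complex) set \<Rightarrow> 'a set \<Rightarrow> ('a \<Rightarrow> complex) set" where
  "regular_on C X = {f. \<forall>x\<in>X. \<exists>p\<in>polys C. \<exists>q\<in>polys C.
     q x \<noteq> 0 \<and> (\<forall>y\<in>X. q y \<noteq> 0 \<longrightarrow> f y = p y / q y)}"

definition regular_map ::
  "('a \<Rightarrow> complex) set \<Rightarrow> ('b \<Rightarrow> complex) set \<Rightarrow> ('a \<Rightarrow> 'b) \<Rightarrow> 'a set \<Rightarrow> 'b set \<Rightarrow> bool" where
  "regular_map C D f X Y \<longleftrightarrow> f ` X \<subseteq> Y \<and> (\<forall>u\<in>D. (\<lambda>x. u (f x)) \<in> regular_on C X)"

definition variety_iso ::
  "('a \<Rightarrow> complex) set \<Rightarrow> ('b \<Rightarrow> complex) set \<Rightarrow> ('a \<Rightarrow> 'b) \<Rightarrow> 'a set \<Rightarrow> 'b set \<Rightarrow> bool" where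
  "variety_iso C D f X Y \<longleftrightarrow> regular_map C D f X Y \<and>
     (\<exists>g. regular_map D C g Y X \<and> (\<forall>x\<in>X. g (f x) = x) \<and> (\<forall>y\<in>Y. f (g y) = y))"

text \<open>The open subset \<open>Gr\<^sub>0\<^sup>-\<close> of the ind-variety \<open>Gr\<close> carries the structure of
  \<open>G(\<O>\<^sup>-)\<^sub>0\<^sup>\<sigma>\<close>, whose coordinates are the coefficients of the powers of \<open>t\<close> in the matrix
  entries.\<close>

definition coords_Gr :: "nat \<Rightarrow> (complex fls mat set \<Rightarrow> complex) set" where
  "coords_Gr l = {(\<lambda>c. fls_nth (rep l c $$ (i,j)) k) | i j k. i < 2*l+1 \<and> j < 2*l+1}"

definition coords_mat :: "nat \<Rightarrow> (complex mat \<Rightarrow> complex) set" where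
  "coords_mat l = {(\<lambda>x. x $$ (i,j)) | i j. i < 2*l+1 \<and> j < 2*l+1}"

definition pi_iso :: "nat \<Rightarrow> complex fls mat set set \<Rightarrow> complex mat set \<Rightarrow> bool" where
  "pi_iso l X Y \<longleftrightarrow> variety_iso (coords_Gr l) (coords_mat l) (pi_map l) X Y"

end

theory Submission
  imports Defs
begin

text \<open>Write \<open>A\<^sup>* = J A\<^sup>T J\<close>. An element \<open>A\<close> of \<open>G(\<K>)\<close> is fixed by \<open>\<sigma>\<close> iff
  \<open>A(t) A(-t)\<^sup>* = I\<close>, so \<open>I + x t\<^sup>-\<^sup>1\<close> is fixed iff \<open>x = x\<^sup>*\<close> and \<open>x\<^sup>2 = 0\<close>. If \<open>A\<close> in
  \<open>G(\<O>\<^sup>-)\<^sub>0\<^sup>\<sigma>\<close> lies over the cell of \<open>(1\<^sup>j 0\<^sup>l\<^sup>-\<^sup>j)\<close>, then \<open>t A\<close> has entries in \<open>\<O>\<close>, hence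
  \<open>A = I + x t\<^sup>-\<^sup>1\<close>, and the elementary divisors of \<open>t A\<close> show that \<open>x\<close>, its value at \<open>t = 0\<close>, has
  rank \<open>j\<close>.

  Conversely, a self-adjoint \<open>x\<close> with \<open>x\<^sup>2 = 0\<close> and rank \<open>j\<close> takes a fixed form in a suitable
  orthonormal basis: as long as \<open>x\<close> is nonzero on the orthogonal complement of the vectors found so
  far, there is \<open>u\<close> in it with \<open>(u, x u) = 1\<close>, and after a correction of \<open>u\<close> by a multiple of \<open>x u\<close>
  the pair \<open>u, x u\<close> spans a hyperbolic plane. Hence \<open>K\<close> acts transitively on these \<open>x\<close> for each \<open>j\<close>,
  and it is enough to write \<open>I + x t\<^sup>-\<^sup>1\<close> as an element of \<open>G(\<O>)\<^sup>\<sigma> n\<^sup>\<lambda> G(\<O>)\<^sup>\<sigma>\<close> for one explicit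
  \<open>x\<close>.\<close>

section \<open>Orthonormal systems adapted to a self-adjoint operator of square zero\<close>

text \<open>Conjugacy under K is finer than similarity, so a Jordan basis of x alone does not settle
  it: the normal form must be reached through a basis W with \<open>W^T J W = I\<close>, and the
  transition between two such bases is an isometry of the form. Isometries have determinant 1 or -1;
  the dimension is odd, so passing from k to -k corrects the sign without changing the conjugation.
  Hence the full orthogonal group and K have the same orbits here. Jordan type, K-orbit and cell are
  compared through a single number, the rank of x. It is handled as a factorization with one-sided
  inverses, which passes through products with invertible matrices without any dimension theory of
  subspaces. The form \<open>I + x t^-1\<close> appears because two conditions bound the exponents
  from opposite sides: entries in \<open>fls_O_minus\<close> have no positive powers of t, and tA
  having entries in \<open>fls_O\<close> excludes everything below \<open>t^-1\<close>. The inverse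
  of the map is therefore explicit, and regularity in both directions is read off from
  coordinates.\<close>

text \<open>Padding with zeros to square matrices of size k keeps the product, but for n < k creates
  a zero row and so determinant 0. This bounds orthonormal systems and makes the rank well
  defined.\<close>

lemma left_inverse_dim_le:
  fixes A B :: "'a::field mat"
  assumes A: "A \<in> carrier_mat n k" and B: "B \<in> carrier_mat k n" and BA: "B * A = 1\<^sub>m k"
  shows "k \<le> n"
proof (rule ccontr)
  assume "\<not> k \<le> n"
  then have nk: "n < k" by simp
  define A' where "A' = mat k k (\<lambda>(r,j). if r < n then A $$ (r,j) else 0)"
  define B' where "B' = mat k k (\<lambda>(i,r). if r < n then B $$ (i,r) else 0)"
  have A': "A' \<in> carrier_mat k k" and B': "B' \<in> carrier_mat k k"
    by (auto simp: A'_def B'_def)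
  have "B' * A' = B * A"
  proof (rule eq_matI)
    fix i j assume "i < dim_row (B * A)" "j < dim_col (B * A)"
    then have ij: "i < k" "j < k" using A B by auto
    have "(B' * A') $$ (i,j) = (\<Sum>r\<in>{0..<k}. if r < n then B $$ (i,r) * A $$ (r,j) else 0)"
      using ij by (auto simp: A'_def B'_def scalar_prod_def intro!: sum.cong)
    also have "\<dots> = (\<Sum>r\<in>{0..<n}. B $$ (i,r) * A $$ (r,j))"
      using nk by (intro sum.mono_neutral_cong_right) auto
    also have "\<dots> = (B * A) $$ (i,j)" using ij A B by (auto simp: scalar_prod_def)
    finally show "(B' * A') $$ (i,j) = (B * A) $$ (i,j)" .
  qed (use A B A' B' in auto)
  then have "det B' * det A' = 1" using det_mult[OF B' A'] BA by simp
  moreover have "det A' = 0"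
  proof -
    have eq: "A' = mat\<^sub>r k k (\<lambda>i. if i = n then 0\<^sub>v k else row A' i)"
      by (rule eq_matI) (auto simp: A'_def)
    show ?thesis by (subst eq, rule det_row_0) (use nk A' in auto)
  qed
  ultimately show False by simp
qed

lemma ex_inverse_square:
  fixes z :: complex
  assumes "z \<noteq> 0"
  obtains c where "c * (c * z) = 1"
proof
  have "csqrt z * csqrt z = z" by (metis power2_csqrt power2_eq_square)
  then show "inverse (csqrt z) * (inverse (csqrt z) * z) = 1"
    using assms by (metis csqrt_eq_0 left_inverse mult.assoc mult.left_neutral)
qed

text \<open>Vectors are functions on all natural numbers, so that linear operations are pointwise
  and carry no dimension. Only coordinates below n count: \<open>B_cong\<close> says so for the
  form, and \<open>B_nondeg\<close> concludes nothing beyond them.\<close>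

locale bilinear_space =
  fixes n :: nat and B :: "(nat \<Rightarrow> complex) \<Rightarrow> (nat \<Rightarrow> complex) \<Rightarrow> complex"
  assumes B_sym: "B u v = B v u"
    and B_add: "B (\<lambda>r. u r + v r) w = B u w + B v w"
    and B_scale: "B (\<lambda>r. c * u r) w = c * B u w"
    and B_cong: "(\<And>r. r < n \<Longrightarrow> u r = v r) \<Longrightarrow> B u w = B v w"
    and B_nondeg: "(\<And>u. B u v = 0) \<Longrightarrow> r < n \<Longrightarrow> v r = 0"
begin

lemma B_add': "B w (\<lambda>r. u r + v r) = B w u + B w v"
  and B_scale': "B w (\<lambda>r. c * u r) = c * B w u"
  by (simp_all only: B_sym[of w] B_add B_scale)

lemma B_diff: "B (\<lambda>r. u r - v r) w = B u w - B v w"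
  using B_add[of u "\<lambda>r. (-1) * v r" w] B_scale[of "-1" v w] by simp

lemma B_diff': "B w (\<lambda>r. u r - v r) = B w u - B w v"
  by (simp only: B_sym[of w] B_diff)

lemma B_zero: "B (\<lambda>r. 0) w = 0" "B w (\<lambda>r. 0) = 0"
  using B_scale[of 0 "\<lambda>r. 0" w] B_sym[of w "\<lambda>r. 0"] by simp_all

lemma B_sum: "B (\<lambda>r. \<Sum>i\<in>I. f i r) w = (\<Sum>i\<in>I. B (f i) w)"
  by (induction I rule: infinite_finite_induct) (simp_all add: B_zero B_add)

lemma B_sum': "B w (\<lambda>r. \<Sum>i\<in>I. f i r) = (\<Sum>i\<in>I. B w (f i))"
  by (simp only: B_sym[of w] B_sum)

lemmas B_linear = B_add B_add' B_scale B_scale' B_diff B_diff' B_zero B_sum B_sum'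

lemma B_expand: "B u v = (\<Sum>r<n. B u (\<lambda>s. if s = r then 1 else 0) * v r)"
proof -
  have "B v u = B (\<lambda>s. \<Sum>r<n. v r * (if s = r then 1 else 0)) u"
    by (rule B_cong) (simp add: if_distrib cong: if_cong)
  also have "\<dots> = (\<Sum>r<n. v r * B (\<lambda>s. if s = r then 1 else 0) u)"
    by (simp only: B_sum B_scale)
  finally show ?thesis by (simp add: B_sym[of u] mult.commute)
qed

definition orthonormal :: "nat \<Rightarrow> (nat \<Rightarrow> nat \<Rightarrow> complex) \<Rightarrow> bool" where
  "orthonormal m w \<longleftrightarrow> (\<forall>i<m. \<forall>k<m. B (w i) (w k) = (if i = k then 1 else 0))"

text \<open>For orthonormal w this is the projection onto the orthogonal complement of the first m
  vectors, not onto their span.\<close>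

definition proj :: "nat \<Rightarrow> (nat \<Rightarrow> nat \<Rightarrow> complex) \<Rightarrow> (nat \<Rightarrow> complex) \<Rightarrow> nat \<Rightarrow> complex" where
  "proj m w u = (\<lambda>r. u r - (\<Sum>i<m. B (w i) u * w i r))"

lemma B_proj: "B v (proj m w u) = B v u - (\<Sum>i<m. B (w i) u * B (w i) v)"
  by (simp add: proj_def B_linear B_sym[of v "w i" for i])

lemma proj_orthogonal:
  assumes "orthonormal m w" "i < m"
  shows "B (w i) (proj m w u) = 0"
proof -
  have "(\<Sum>k<m. B (w k) u * B (w k) (w i)) = (\<Sum>k<m. if k = i then B (w k) u else 0)"
    using assms by (intro sum.cong) (auto simp: orthonormal_def)
  then show ?thesis using assms(2) by (simp add: B_proj)
qed

text \<open>The matrix of the functionals \<open>B (w i)\<close> is a left inverse of the matrix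
  with columns \<open>w k\<close>.\<close>

lemma orthonormal_le: "orthonormal m w \<Longrightarrow> m \<le> n"
proof (rule left_inverse_dim_le)
  assume *: "orthonormal m w"
  let ?A = "mat n m (\<lambda>(r,k). w k r)"
  let ?B = "mat m n (\<lambda>(i,r). B (w i) (\<lambda>s. if s = r then 1 else 0))"
  show "?A \<in> carrier_mat n m" "?B \<in> carrier_mat m n" by auto
  show "?B * ?A = 1\<^sub>m m"
  proof (rule eq_matI)
    fix i k assume "i < dim_row (1\<^sub>m m)" "k < dim_col (1\<^sub>m m)"
    then have ik: "i < m" "k < m" by auto
    then have "(?B * ?A) $$ (i,k) = B (w i) (w k)"
      by (subst B_expand) (simp add: scalar_prod_def lessThan_atLeast0)
    then show "(?B * ?A) $$ (i,k) = 1\<^sub>m m $$ (i,k)" using ik * by (simp add: orthonormal_def)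
  qed auto
qed

text \<open>Expansion at u + v leaves twice the mixed term. It turns the failure to find a vector
  with nonzero value into the vanishing of a whole operator.\<close>

lemma polarize:
  assumes "\<And>u. B u (T u) = 0" "\<And>u v. T (\<lambda>r. u r + v r) = (\<lambda>r. T u r + T v r)"
    and "\<And>u v. B u (T v) = B v (T u)"
  shows "B u (T v) = 0"
  using assms(1)[of "\<lambda>r. u r + v r"] assms(1)[of u] assms(1)[of v] assms(3)[of u v]
  by (simp add: assms(2) B_linear)

lemma proj_add: "proj m w (\<lambda>r. u r + v r) = (\<lambda>r. proj m w u r + proj m w v r)"
  by (auto simp: proj_def B_linear distrib_right sum.distrib)

lemma orthonormal_extend:
  assumes on: "orthonormal m w" and "m < n"
  obtains u where "u = proj m w u" "B u u = 1" "\<And>i. i < m \<Longrightarrow> B (w i) u = 0"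
proof -
  have "\<exists>u. B u (proj m w u) \<noteq> 0"
  proof (rule ccontr)
    assume "\<nexists>u. B u (proj m w u) \<noteq> 0"
    then have *: "B u (proj m w u) = 0" for u by blast
    have z: "B u (proj m w v) = 0" for u v
    proof (rule polarize[where T = "proj m w"])
      show "B u (proj m w v) = B v (proj m w u)" for u v
        using B_sym[of u v] by (simp add: B_proj mult.commute)
    qed (simp_all add: proj_add *)
    \<comment> \<open>With the projection equal to zero, the identity is the sum of the rank one
      maps \<open>u \<mapsto> B (w i) u * w i\<close>. Fact \<open>d\<close> is its r-th diagonal
      entry, and comparing traces gives n = m.\<close>
    let ?d = "\<lambda>r s. if s = r then 1 else 0 :: complex"
    have d: "1 = (\<Sum>i<m. B (w i) (?d r) * w i r)" if "r < n" for r
      using B_nondeg[OF z that, of "?d r"] by (simp add: proj_def)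
    have "of_nat n = (\<Sum>r<n. (1::complex))" by simp
    also have "\<dots> = (\<Sum>r<n. \<Sum>i<m. B (w i) (?d r) * w i r)" using d by (intro sum.cong) auto
    also have "\<dots> = (\<Sum>i<m. B (w i) (w i))"
      by (subst sum.swap) (intro sum.cong refl B_expand[symmetric])
    also have "\<dots> = of_nat m" using on by (simp add: orthonormal_def)
    finally show False using \<open>m < n\<close> by simp
  qed
  then obtain u where u: "B u (proj m w u) \<noteq> 0" by blast
  obtain c where c: "c * (c * B u (proj m w u)) = 1" using ex_inverse_square[OF u] by blast
  define v where "v = (\<lambda>r. c * proj m w u r)"
  have o: "B (w i) v = 0" if "i < m" for i
    using that by (simp add: v_def B_linear proj_orthogonal[OF on])
  have "B (proj m w u) (proj m w u) = B u (proj m w u)"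
    by (subst B_proj) (simp add: proj_orthogonal[OF on] B_sym[of "proj m w u" u])
  then have "B v v = 1"
    using c by (simp only: v_def B_scale B_scale')
  moreover have "v = proj m w v" using o by (simp add: proj_def)
  ultimately show ?thesis using o that by blast
qed

lemma orthonormal_Suc:
  assumes "orthonormal m w" "B a a = 1" "\<And>i. i < m \<Longrightarrow> B (w i) a = 0"
  shows "orthonormal (Suc m) (w(m := a))"
  using assms B_sym[of a "w i" for i] by (auto simp: orthonormal_def less_Suc_eq)

end

text \<open>\<open>X_beyond\<close> pins down the coordinates that the form cannot see, so that
  \<open>X u = 0\<close> can be stated as an equality of functions.\<close>

locale square_zero_operator = bilinear_space +
  fixes X :: "(nat \<Rightarrow> complex) \<Rightarrow> nat \<Rightarrow> complex"
  assumes X_add: "X (\<lambda>r. u r + v r) = (\<lambda>r. X u r + X v r)"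
    and X_scale: "X (\<lambda>r. c * u r) = (\<lambda>r. c * X u r)"
    and X_self_adjoint: "B (X u) v = B u (X v)"
    and X_square: "X (X u) = (\<lambda>r. 0)"
    and X_beyond: "r \<ge> n \<Longrightarrow> X u r = 0"
begin

lemma X_diff: "X (\<lambda>r. u r - v r) = (\<lambda>r. X u r - X v r)"
  using X_add[of u "\<lambda>r. (-1) * v r"] X_scale[of "-1" v] by simp

text \<open>On each plane X has the matrix with rows \<open>(1, \<i>)\<close> and
  \<open>(\<i>, -1)\<close>: symmetric, as self-adjointness demands in an orthonormal basis, and of
  square zero since \<open>1 + \<i>^2 = 0\<close>.\<close>

definition adapted :: "nat \<Rightarrow> (nat \<Rightarrow> nat \<Rightarrow> complex) \<Rightarrow> bool" where
  "adapted j w \<longleftrightarrow> (\<forall>i<j. X (w (2*i)) = (\<lambda>r. w (2*i) r + \<i> * w (2*i+1) r) \<and>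
     X (w (2*i+1)) = (\<lambda>r. \<i> * w (2*i) r - w (2*i+1) r))"

text \<open>The span of the first 2j vectors is stable under X; since X is self-adjoint, so is its
  orthogonal complement.\<close>

lemma adapted_image_orthogonal:
  assumes "adapted j w" "i < 2*j" "\<And>k. k < 2*j \<Longrightarrow> B (w k) u = 0"
  shows "B (X (w i)) u = 0"
proof (cases "even i")
  case True
  then obtain k where "i = 2*k" by blast
  then show ?thesis using assms by (simp add: adapted_def B_linear)
next
  case False
  then obtain k where "i = 2*k+1" using oddE by blast
  then show ?thesis using assms by (simp add: adapted_def B_linear)
qed

lemma adapted_step:
  assumes on: "orthonormal (2*j) w" and ad: "adapted j w"
    and u0: "B u0 (X (proj (2*j) w u0)) \<noteq> 0"
  obtains w' where "orthonormal (2 * Suc j) w'" "adapted (Suc j) w'"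
proof -
  obtain c where c: "c * (c * B u0 (X (proj (2*j) w u0))) = 1"
    using ex_inverse_square[OF u0] by blast
  define p where "p = proj (2*j) w u0"
  have op: "B (w i) p = 0" if "i < 2*j" for i
    using proj_orthogonal[OF on that] by (simp add: p_def)
  \<comment> \<open>\<open>X p\<close> stays orthogonal to the old vectors, so replacing
    \<open>u0\<close> by its projection p on the left does not change the value of the form.\<close>
  have oXp: "B (w i) (X p) = 0" if "i < 2*j" for i
    using adapted_image_orthogonal[OF ad that op] by (simp add: X_self_adjoint)
  have "B p (X p) = B (X p) (proj (2*j) w u0)" by (simp add: B_sym p_def)
  also have "\<dots> = B u0 (X p)" using oXp by (simp add: B_proj B_sym[of "X p" u0])
  finally have pXp: "B p (X p) = B u0 (X p)" .
  define u1 where "u1 = (\<lambda>r. c * p r)"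
  define v where "v = X u1"
  \<comment> \<open>v is isotropic because X is self-adjoint of square zero. Subtracting this
    multiple of v therefore kills \<open>B u u\<close> and leaves \<open>B u v = 1\<close>.\<close>
  define u where "u = (\<lambda>r. u1 r - (B u1 u1 / 2) * v r)"
  have u1v: "B u1 v = 1" "B v u1 = 1"
    using c pXp B_sym[of v u1] by (simp_all add: u1_def v_def X_scale B_linear p_def)
  have vv: "B v v = 0"
    using X_self_adjoint[of u1 v] by (simp add: v_def X_square B_linear)
  have uv: "B u v = 1" "B v u = 1" unfolding u_def B_linear u1v vv by simp_all
  have uu: "B u u = 0"
    unfolding u_def B_linear u1v vv by simp
  have ow: "B (w i) u = 0" "B (w i) v = 0" if "i < 2*j" for i
  proof -
    have "B (w i) u1 = 0" unfolding u1_def B_linear op[OF that] by simp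
    moreover show "B (w i) v = 0" unfolding v_def u1_def X_scale B_linear oXp[OF that] by simp
    ultimately show "B (w i) u = 0" unfolding u_def B_linear by simp
  qed
  have Xv: "X v = (\<lambda>r. 0)" by (simp add: v_def X_square)
  have Xu: "X u = v" unfolding u_def X_diff X_scale Xv by (simp add: v_def)
  \<comment> \<open>An orthonormal basis of the hyperbolic plane, with coefficients chosen so that
    \<open>a + \<i> b = v\<close> and \<open>\<i> a - b = \<i> v\<close>; these are
    \<open>X a\<close> and \<open>X b\<close>.\<close>
  define a where "a = (\<lambda>r. (1/2) * v r + u r)"
  define b where "b = (\<lambda>r. (- \<i>/2) * v r + \<i> * u r)"
  have B_ab: "B a a = 1" "B b b = 1" "B a b = 0"
    unfolding a_def b_def B_linear uu uv vv by simp_all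
  have o_ab: "B (w i) a = 0" "B (w i) b = 0" if "i < 2*j" for i
    unfolding a_def b_def B_linear ow[OF that] by simp_all
  define w' where "w' = (w(2*j := a))(Suc (2*j) := b)"
  have "orthonormal (2 * Suc j) w'"
    unfolding w'_def mult_Suc_right add_2_eq_Suc
    using o_ab B_ab by (intro orthonormal_Suc on) (auto simp: less_Suc_eq)
  moreover have Xa: "X a = (\<lambda>r. a r + \<i> * b r)" and Xb: "X b = (\<lambda>r. \<i> * a r - b r)"
    unfolding a_def b_def X_add X_scale Xu Xv by (auto simp: algebra_simps)
  have "adapted (Suc j) w'"
    unfolding adapted_def
  proof (intro allI impI)
    fix i assume "i < Suc j"
    then consider "i < j" | "i = j" by linarith
    then show "X (w' (2*i)) = (\<lambda>r. w' (2*i) r + \<i> * w' (2*i+1) r) \<and>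
       X (w' (2*i+1)) = (\<lambda>r. \<i> * w' (2*i) r - w' (2*i+1) r)"
    proof cases
      case 1
      then show ?thesis using ad by (simp add: w'_def adapted_def)
    next
      case 2
      then show ?thesis using Xa Xb by (simp add: w'_def)
    qed
  qed
  ultimately show ?thesis using that by blast
qed

text \<open>For a maximal adapted system, X vanishes on the orthogonal complement, so any
  orthonormal completion is annihilated by X.\<close>

lemma exists_adapted_basis:
  obtains j w where "2*j \<le> n" "orthonormal n w" "adapted j w"
    "\<And>i. 2*j \<le> i \<Longrightarrow> i < n \<Longrightarrow> X (w i) = (\<lambda>r. 0)"
proof -
  let ?Q = "\<lambda>j. \<exists>w. orthonormal (2*j) w \<and> adapted j w"
  have "?Q 0" by (simp add: orthonormal_def adapted_def)
  moreover have bound: "\<forall>j. ?Q j \<longrightarrow> j \<le> n" using orthonormal_le by fastforce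
  ultimately obtain j where j: "?Q j" and max: "\<And>k. ?Q k \<Longrightarrow> k \<le> j"
    using Nat.ex_has_greatest_nat[of ?Q 0 n] by blast
  then obtain w0 where on: "orthonormal (2*j) w0" and ad: "adapted j w0" by blast
  \<comment> \<open>A nonzero value would allow \<open>adapted_step\<close> to produce a longer
    system, against maximality of j.\<close>
  have z: "B u (X (proj (2*j) w0 u)) = 0" for u
    using adapted_step[OF on ad, of u] max[of "Suc j"] by (metis Suc_n_not_le_n)
  have sym: "B u (X (proj (2*j) w0 v)) = B v (X (proj (2*j) w0 u))" for u v
  proof -
    \<comment> \<open>\<open>X (proj (2*j) w0 v)\<close> is orthogonal to the first 2j vectors, so u
      may be projected as well. The resulting expression is symmetric in u and v, as polarization
      requires.\<close>
    have *: "B u (X (proj (2*j) w0 v)) = B (proj (2*j) w0 u) (X (proj (2*j) w0 v))" for u v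
    proof -
      have "B (w0 i) (X (proj (2*j) w0 v)) = 0" if "i < 2*j" for i
        using adapted_image_orthogonal[OF ad that] proj_orthogonal[OF on]
        by (simp add: X_self_adjoint)
      then show ?thesis
        by (subst B_sym[of "proj (2*j) w0 u"])
          (simp add: B_proj B_sym[of "X (proj (2*j) w0 v)" u])
    qed
    show ?thesis using *[of u v] *[of v u] X_self_adjoint B_sym by metis
  qed
  have "B u (X (proj (2*j) w0 v)) = 0" for u v
    by (rule polarize[where T = "\<lambda>u. X (proj (2*j) w0 u)"]) (simp_all add: z sym proj_add X_add)
  then have XP: "X (proj (2*j) w0 v) = (\<lambda>r. 0)" for v
    using B_nondeg X_beyond by (metis not_le)
  \<comment> \<open>A vector orthogonal to the first 2j vectors is its own projection, hence killed
    by X. Carrying the agreement with \<open>w0\<close> through the induction keeps this applicable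
    to every new vector.\<close>
  have "\<exists>w. orthonormal m w \<and> adapted j w \<and>
      (\<forall>i. 2*j \<le> i \<and> i < m \<longrightarrow> X (w i) = (\<lambda>r. 0)) \<and> (\<forall>i<2*j. w i = w0 i)"
    if "2*j \<le> m" "m \<le> n" for m
    using that
  proof (induction m rule: dec_induct)
    case base
    then show ?case using on ad by auto
  next
    case (step m)
    then obtain w where w: "orthonormal m w" "adapted j w" "\<forall>i<2*j. w i = w0 i"
      "\<And>i. 2*j \<le> i \<Longrightarrow> i < m \<Longrightarrow> X (w i) = (\<lambda>r. 0)" by auto
    obtain u where u: "B u u = 1" "\<And>i. i < m \<Longrightarrow> B (w i) u = 0"
      using orthonormal_extend[OF w(1)] step.prems by (metis Suc_le_lessD)
    have "B (w0 i) u = 0" if "i < 2*j" for i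
      using u(2)[of i] w(3) step.hyps that by simp
    then have "proj (2*j) w0 u = u" by (simp add: proj_def)
    then have "X u = (\<lambda>r. 0)" using XP[of u] by simp
    then have "\<forall>i. 2*j \<le> i \<and> i < Suc m \<longrightarrow> X ((w(m := u)) i) = (\<lambda>r. 0)"
      using w(4) by (auto simp: less_Suc_eq)
    moreover have "adapted j (w(m := u))"
      using w(2) step.hyps by (auto simp: adapted_def)
    moreover have "\<forall>i<2*j. (w(m := u)) i = w0 i" using w(3) step.hyps by auto
    ultimately show ?case using orthonormal_Suc[OF w(1) u] by blast
  qed
  from this[of n] orthonormal_le[OF on] show ?thesis using that orthonormal_le[OF on] by auto
qed

end

section \<open>The involution on matrices\<close>

lemma minv_eqI:
  assumes A: "A \<in> carrier_mat n n" and B: "B \<in> carrier_mat n n" and AB: "A * B = 1\<^sub>m n"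
  shows "minv A = B"
proof -
  have BA: "B * A = 1\<^sub>m n" by (rule mat_mult_left_right_inverse[OF A B AB])
  have "A \<in> Units (ring_mat TYPE('a) n ())"
    using A B AB BA by (auto simp: Units_def ring_mat_simps)
  then obtain C where C: "mat_inverse A = Some C" using mat_inverse(1)[OF A] by fastforce
  then have CA: "C * A = 1\<^sub>m n" and C': "C \<in> carrier_mat n n"
    using mat_inverse(2)[OF A C] by auto
  have "C = C * (A * B)" using AB C' by simp
  also have "\<dots> = B" using assoc_mult_mat[OF C' A B] CA B by simp
  finally show ?thesis by (simp add: minv_def C)
qed

lemma SL_inverse:
  assumes "A \<in> SL n"
  obtains B where "B \<in> carrier_mat n n" "A * B = 1\<^sub>m n" "B * A = 1\<^sub>m n" "minv A = B"
proof -
  have A: "A \<in> carrier_mat n n" and "det A \<noteq> 0" using assms by (auto simp: SL_def)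
  from det_non_zero_imp_unit[OF this, of "()"] obtain B where
    "B \<in> carrier_mat n n" "A * B = 1\<^sub>m n" "B * A = 1\<^sub>m n"
    by (auto simp: Units_def ring_mat_simps)
  then show ?thesis using that minv_eqI[OF A] by blast
qed

text \<open>The adjoint for the form \<open>(u, v) \<mapsto> u\<^sup>T J v\<close> (not the adjugate).\<close>

definition adj :: "nat \<Rightarrow> 'a::field mat \<Rightarrow> 'a mat" where
  "adj l A = Jmat l * transpose_mat A * Jmat l"

locale odd_dimension =
  fixes l n :: nat
  assumes n_eq: "n = 2*l+1"
begin

lemmas carrier_simps [simp] = mult_carrier_mat[of _ n n _ n]
lemmas mult_assoc = assoc_mult_mat[of _ n n _ n _ n]

lemma Jmat_carrier [simp]: "Jmat l \<in> carrier_mat n n"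
  by (simp add: Jmat_def n_eq)

lemma Jmat_dim [simp]: "dim_row (Jmat l) = n" "dim_col (Jmat l) = n"
  by (simp_all add: Jmat_def n_eq)

lemma Jmat_index: "i < n \<Longrightarrow> j < n \<Longrightarrow> Jmat l $$ (i,j) = (if i + j = 2*l then (-1)^i else 0)"
  by (simp add: Jmat_def n_eq)

lemma adj_carrier [simp]: "A \<in> carrier_mat n n \<Longrightarrow> adj l A \<in> carrier_mat n n"
  by (simp add: adj_def)

lemma adj_dim [simp]: "dim_row (adj l A) = n" "dim_col (adj l A) = n"
  by (simp_all add: adj_def)

lemma reflect_less [simp]: "2*l - i < n"
  by (simp add: n_eq)

lemma Jmat_mult_index:
  assumes "A \<in> carrier_mat n m" "i < n" "j < m"
  shows "(Jmat l * A) $$ (i,j) = (-1)^i * A $$ (2*l-i,j)"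
proof -
  have "(Jmat l * A) $$ (i,j) = (\<Sum>k\<in>{0..<n}. Jmat l $$ (i,k) * A $$ (k,j))"
    using assms by (simp add: scalar_prod_def)
  also have "\<dots> = (\<Sum>k\<in>{0..<n}. if k = 2*l - i then (-1)^i * A $$ (k,j) else 0)"
    using assms(2) n_eq by (intro sum.cong) (auto simp: Jmat_index)
  finally show ?thesis by simp
qed

text \<open>Reflection of indices preserves parity because 2l is even; this is what makes J
  symmetric and its own inverse.\<close>

lemma minus_one_power_reflect: "i < n \<Longrightarrow> (-1 :: 'a::ring_1) ^ (2*l - i) = (-1) ^ i"
  by (simp add: n_eq minus_one_power_iff)

lemma mult_Jmat_index:
  assumes "A \<in> carrier_mat m n" "i < m" "j < n"
  shows "(A * Jmat l) $$ (i,j) = (-1)^j * A $$ (i,2*l-j)"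
proof -
  have "(A * Jmat l) $$ (i,j) = (\<Sum>k\<in>{0..<n}. A $$ (i,k) * Jmat l $$ (k,j))"
    using assms by (simp add: scalar_prod_def)
  also have "\<dots> = (\<Sum>k\<in>{0..<n}. if k = 2*l - j then (-1)^k * A $$ (i,k) else 0)"
    using assms(3) n_eq by (intro sum.cong) (auto simp: Jmat_index)
  finally show ?thesis using assms(3) by (simp add: minus_one_power_reflect)
qed

lemma adj_index:
  assumes "A \<in> carrier_mat n n" "i < n" "j < n"
  shows "adj l A $$ (i,j) = (-1)^(i+j) * A $$ (2*l-j,2*l-i)"
proof -
  have "adj l A $$ (i,j) = (-1)^j * (Jmat l * transpose_mat A) $$ (i,2*l-j)"
    unfolding adj_def using assms by (intro mult_Jmat_index) auto
  also have "(Jmat l * transpose_mat A) $$ (i,2*l-j) = (-1)^i * transpose_mat A $$ (2*l-i,2*l-j)"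
    using assms by (intro Jmat_mult_index) auto
  finally show ?thesis using assms by (simp add: power_add)
qed

lemma Jmat_square: "Jmat l * Jmat l = (1\<^sub>m n :: 'a::field mat)"
proof (rule eq_matI)
  fix i j assume "i < dim_row (1\<^sub>m n :: 'a mat)" "j < dim_col (1\<^sub>m n :: 'a mat)"
  then have ij: "i < n" "j < n" by auto
  have "(2*l - i + j = 2*l) = (i = j)" using ij n_eq by auto
  moreover have "(-1::'a) ^ i * (-1) ^ i = 1" by (simp flip: power_mult_distrib)
  ultimately show "(Jmat l * Jmat l) $$ (i,j) = (1\<^sub>m n :: 'a mat) $$ (i,j)"
    using ij unfolding Jmat_mult_index[OF Jmat_carrier ij]
    by (auto simp: Jmat_index minus_one_power_reflect)
qed simp_all

lemma Jmat_cancel: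
  assumes "A \<in> carrier_mat n m"
  shows "Jmat l * (Jmat l * A) = A"
  using assms by (simp add: Jmat_square flip: assoc_mult_mat[of _ n n _ n _ m])

lemma Jmat_transpose: "transpose_mat (Jmat l) = Jmat l"
proof (rule eq_matI)
  fix i j assume ij: "i < dim_row (Jmat l)" "j < dim_col (Jmat l)"
  have "(-1) ^ i = (-1 :: 'a) ^ j" if "i + j = 2*l"
    using minus_one_power_reflect[of j] ij that by (metis Jmat_dim(2) add_diff_cancel_right')
  then show "transpose_mat (Jmat l) $$ (i,j) = (Jmat l :: 'a mat) $$ (i,j)"
    using ij by (auto simp: Jmat_index add.commute)
qed simp_all

lemma minv_Jmat: "minv (Jmat l) = (Jmat l :: 'a::field mat)"
  by (rule minv_eqI[OF _ _ Jmat_square]) auto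

lemma adj_adj:
  assumes "A \<in> carrier_mat n n"
  shows "adj l (adj l A) = A"
proof (rule eq_matI)
  fix i j assume "i < dim_row A" "j < dim_col A"
  then have ij: "i < n" "j < n" using assms by auto
  have "2*l - (2*l - i) = i" "2*l - (2*l - j) = j" using ij n_eq by auto
  moreover have "(-1::'a) ^ (i+j) * (-1) ^ (2*l-j + (2*l-i)) = 1"
    using ij by (simp add: n_eq minus_one_power_iff)
  ultimately show "adj l (adj l A) $$ (i,j) = A $$ (i,j)"
    using ij assms by (simp add: adj_index flip: mult.assoc)
qed (use assms in auto)

lemma adj_mult:
  assumes "A \<in> carrier_mat n n" "B \<in> carrier_mat n n"
  shows "adj l (A * B) = adj l B * adj l A"
proof -
  have "adj l B * adj l A
      = Jmat l * (transpose_mat B * (Jmat l * (Jmat l * (transpose_mat A * Jmat l))))"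
    using assms by (simp add: adj_def mult_assoc)
  also have "\<dots> = adj l (A * B)"
    using assms
    by (simp add: adj_def Jmat_cancel[where m = n] transpose_mult[of _ n n _ n] mult_assoc)
  finally show ?thesis by simp
qed

lemma adj_one: "adj l (1\<^sub>m n) = 1\<^sub>m n"
  by (simp add: adj_def Jmat_square right_mult_one_mat[OF Jmat_carrier])

lemma theta_eq: "theta l A = adj l (minv A)"
  by (simp add: theta_def adj_def minv_Jmat)

lemma theta_fixed_iff:
  assumes "A \<in> SL n"
  shows "theta l A = A \<longleftrightarrow> A * adj l A = 1\<^sub>m n"
proof -
  have A: "A \<in> carrier_mat n n" using assms by (simp add: SL_def)
  obtain B where B: "B \<in> carrier_mat n n" "A * B = 1\<^sub>m n" "minv A = B"
    using SL_inverse[OF assms] .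
  show ?thesis
    using A B adj_adj minv_eqI[OF A adj_carrier[OF A]] by (metis theta_eq)
qed

lemma Kgrp_iff: "k \<in> Kgrp l \<longleftrightarrow> k \<in> carrier_mat n n \<and> det k = 1 \<and> k * adj l k = 1\<^sub>m n"
  using theta_fixed_iff[of k] unfolding Kgrp_def n_eq[symmetric] by (auto simp: SL_def)

lemma pspace_iff:
  "x \<in> pspace l \<longleftrightarrow> x \<in> carrier_mat n n \<and> (\<Sum>i<n. x $$ (i,i)) = 0 \<and> adj l x = x"
  unfolding pspace_def sl_def n_eq[symmetric] adj_def minv_Jmat by auto

end

section \<open>Rank and Jordan form in square zero\<close>

text \<open>A full rank factorization through dimension j, with one-sided inverses L and R as
  witnesses that neither factor degenerates.\<close>

definition has_rank :: "nat \<Rightarrow> nat \<Rightarrow> 'a::field mat \<Rightarrow> bool" where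
  "has_rank n j A \<longleftrightarrow> (\<exists>E F L R. E \<in> carrier_mat n j \<and> F \<in> carrier_mat j n \<and>
     L \<in> carrier_mat j n \<and> R \<in> carrier_mat n j \<and> A = E * F \<and> L * E = 1\<^sub>m j \<and> F * R = 1\<^sub>m j)"

text \<open>Squeezing A between L and R gives the identity of size j, which the second factorization
  routes through dimension k.\<close>

lemma has_rank_le:
  assumes "has_rank n j A" "has_rank n k A"
  shows "j \<le> k"
proof -
  obtain E F L R where 1: "E \<in> carrier_mat n j" "F \<in> carrier_mat j n" "L \<in> carrier_mat j n"
    "R \<in> carrier_mat n j" "A = E * F" "L * E = 1\<^sub>m j" "F * R = 1\<^sub>m j"
    using assms(1) unfolding has_rank_def by blast
  obtain E' F' where 2: "E' \<in> carrier_mat n k" "F' \<in> carrier_mat k n" "A = E' * F'"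
    using assms(2) unfolding has_rank_def by blast
  have "(L * E') * (F' * R) = L * (E' * (F' * R))"
    using 1 2 by (intro assoc_mult_mat[of _ j n _ k _ j]) auto
  also have "E' * (F' * R) = A * R"
    using assoc_mult_mat[OF 2(1,2) 1(4)] 2(3) by simp
  also have "A * R = E * (F * R)"
    using assoc_mult_mat[OF 1(1,2,4)] 1(5) by simp
  also have "L * \<dots> = 1\<^sub>m j" using 1 by simp
  finally have eq: "(L * E') * (F' * R) = 1\<^sub>m j" .
  show ?thesis
    by (rule left_inverse_dim_le[OF _ _ eq]) (use 1 2 in \<open>auto intro: mult_carrier_mat\<close>)
qed

lemma has_rank_unique: "has_rank n j A \<Longrightarrow> has_rank n k A \<Longrightarrow> j = k"
  using has_rank_le by (metis le_antisym)

lemma has_rank_mult: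
  assumes "has_rank n j A"
    and S: "S \<in> carrier_mat n n" "S' \<in> carrier_mat n n" "S' * S = 1\<^sub>m n"
    and T: "T \<in> carrier_mat n n" "T' \<in> carrier_mat n n" "T * T' = 1\<^sub>m n"
  shows "has_rank n j (S * A * T)"
proof -
  obtain E F L R where 1: "E \<in> carrier_mat n j" "F \<in> carrier_mat j n" "L \<in> carrier_mat j n"
    "R \<in> carrier_mat n j" "A = E * F" "L * E = 1\<^sub>m j" "F * R = 1\<^sub>m j"
    using assms(1) unfolding has_rank_def by blast
  have SE: "S * E \<in> carrier_mat n j" and FT: "F * T \<in> carrier_mat j n"
    and LS: "L * S' \<in> carrier_mat j n" and TR: "T' * R \<in> carrier_mat n j"
    using 1 S T by (auto intro: mult_carrier_mat)
  have "S * A * T = S * E * (F * T)"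
    using 1 S T SE FT assoc_mult_mat[OF SE 1(2) T(1)] assoc_mult_mat[OF S(1) 1(1,2)] by simp
  moreover have "L * S' * (S * E) = 1\<^sub>m j"
    using 1 S assoc_mult_mat[OF 1(3) S(2) SE] assoc_mult_mat[OF S(2,1) 1(1)] by simp
  moreover have "F * T * (T' * R) = 1\<^sub>m j"
    using 1 T assoc_mult_mat[OF 1(2) T(1) TR] assoc_mult_mat[OF T(1,2) 1(4)] by simp
  ultimately show ?thesis unfolding has_rank_def using SE FT LS TR by blast
qed

lemma has_rank_similar:
  assumes "similar_mat A B" "B \<in> carrier_mat n n"
  shows "has_rank n j A \<longleftrightarrow> has_rank n j B"
proof -
  obtain m P Q where PQ: "{A,B,P,Q} \<subseteq> carrier_mat m m" "P * Q = 1\<^sub>m m" "Q * P = 1\<^sub>m m" "A = P * B * Q"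
    using similar_matD[OF assms(1)] by blast
  with assms(2) have "m = n" by auto
  have "Q * A * P = (Q * P) * B * (Q * P)"
    unfolding PQ(4) using PQ(1) by (simp add: assoc_mult_mat[of _ m m _ m _ m] mult_carrier_mat[of _ m m _ m])
  then have "B = Q * A * P" using PQ by (metis insert_subset left_mult_one_mat right_mult_one_mat)
  then show ?thesis
    using PQ \<open>m = n\<close> has_rank_mult[of n j A Q P P Q] has_rank_mult[of n j B P Q Q P] by auto
qed

text \<open>Injectivity of p and q puts the j nonzero entries in distinct rows and columns. This
  computes the rank of all three explicit matrices that occur: the Jordan matrix,
  \<open>std j\<close>, and the value of \<open>t n^\<lambda>\<close> at t = 0.\<close>

lemma has_rank_partial_monomial:
  fixes s :: "nat \<Rightarrow> 'a::field"
  assumes "\<And>i. i < j \<Longrightarrow> p i < n \<and> q i < n \<and> s i \<noteq> 0"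
    and inj: "inj_on p {..<j}" "inj_on q {..<j}"
    and A: "A = mat n n (\<lambda>(a,b). \<Sum>i<j. if a = p i \<and> b = q i then s i else 0)"
  shows "has_rank n j A"
  unfolding has_rank_def
proof (intro exI conjI)
  let ?E = "mat n j (\<lambda>(a,i). if a = p i then s i else 0)"
  let ?F = "mat j n (\<lambda>(i,b). if b = q i then 1 else 0 :: 'a)"
  let ?L = "mat j n (\<lambda>(i,a). if a = p i then 1 / s i else 0)"
  let ?R = "mat n j (\<lambda>(b,i). if b = q i then 1 else 0 :: 'a)"
  show "?E \<in> carrier_mat n j" "?F \<in> carrier_mat j n" "?L \<in> carrier_mat j n" "?R \<in> carrier_mat n j"
    by auto
  show "A = ?E * ?F"
  proof (rule eq_matI)
    fix a b assume "a < dim_row (?E * ?F)" "b < dim_col (?E * ?F)"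
    then have ab: "a < n" "b < n" by auto
    then show "A $$ (a,b) = (?E * ?F) $$ (a,b)"
      by (auto simp: A scalar_prod_def lessThan_atLeast0 intro!: sum.cong)
  qed (auto simp: A)
  show "?L * ?E = 1\<^sub>m j"
  proof (rule eq_matI)
    fix i k assume "i < dim_row (1\<^sub>m j :: 'a mat)" "k < dim_col (1\<^sub>m j :: 'a mat)"
    then have ik: "i < j" "k < j" by auto
    have "(?L * ?E) $$ (i,k) = (\<Sum>a\<in>{0..<n}. if a = p i then (if i = k then 1 else 0) else 0)"
    proof -
      have "(?L * ?E) $$ (i,k) = (\<Sum>a\<in>{0..<n}. (if a = p i then 1 / s i else 0) * (if a = p k then s k else 0))"
        using ik by (simp add: scalar_prod_def)
      also have "\<dots> = (\<Sum>a\<in>{0..<n}. if a = p i then (if i = k then 1 else 0) else 0)"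
        using ik inj(1) assms(1) by (intro sum.cong refl) (auto simp: inj_on_def)
      finally show ?thesis .
    qed
    then show "(?L * ?E) $$ (i,k) = 1\<^sub>m j $$ (i,k)" using ik assms(1)[OF ik(1)] by simp
  qed auto
  show "?F * ?R = 1\<^sub>m j"
  proof (rule eq_matI)
    fix i k assume "i < dim_row (1\<^sub>m j :: 'a mat)" "k < dim_col (1\<^sub>m j :: 'a mat)"
    then have ik: "i < j" "k < j" by auto
    have "(?F * ?R) $$ (i,k) = (\<Sum>a\<in>{0..<n}. if a = q i then (if i = k then 1 else 0) else 0)"
    proof -
      have "(?F * ?R) $$ (i,k) = (\<Sum>a\<in>{0..<n}. (if a = q i then 1 else 0 :: 'a) * (if a = q k then 1 else 0))"
        using ik by (simp add: scalar_prod_def)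
      also have "\<dots> = (\<Sum>a\<in>{0..<n}. if a = q i then (if i = k then 1 else 0) else 0)"
        using ik inj(2) assms(1) by (intro sum.cong refl) (auto simp: inj_on_def)
      finally show ?thesis .
    qed
    then show "(?F * ?R) $$ (i,k) = 1\<^sub>m j $$ (i,k)" using ik assms(1)[OF ik(1)] by simp
  qed auto
qed

definition jordan_square_zero :: "nat \<Rightarrow> nat \<Rightarrow> complex mat" where
  "jordan_square_zero n j = mat n n (\<lambda>(p,q). if q < 2*j \<and> odd q \<and> Suc p = q then 1 else 0)"

lemma jordan_matrix_replicate_one:
  "jordan_matrix (replicate m (1,0)) = (0\<^sub>m m m :: complex mat)"
proof (induction m)
  case (Suc m)
  then show ?case
    by (auto simp: jordan_matrix_def Let_def intro!: eq_matI)
qed (simp add: jordan_matrix_def)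

lemma jordan_matrix_square_zero:
  "jordan_matrix (replicate j (2,0) @ replicate m (1,0)) = jordan_square_zero (2*j+m) j"
proof (induction j)
  case 0
  then show ?case
    by (simp only: replicate_0 append_Nil jordan_matrix_replicate_one)
      (auto simp: jordan_square_zero_def intro!: eq_matI)
next
  case (Suc j)
  let ?M = "jordan_matrix (replicate j (2,0) @ replicate m (1,0)) :: complex mat"
  have "jordan_matrix (replicate (Suc j) (2,0) @ replicate m (1,0)) =
      four_block_mat (jordan_block 2 0) (0\<^sub>m 2 (2*j+m)) (0\<^sub>m (2*j+m) 2) ?M"
    using jordan_matrix_dim[of "replicate j (2,0) @ replicate m (1,0) :: (nat \<times> complex) list"]
    by (simp add: jordan_matrix_def Let_def sum_list_replicate mult.commute)
  also have "\<dots> = jordan_square_zero (2 * Suc j + m) (Suc j)"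
    unfolding Suc
    by (rule eq_matI) (auto simp: jordan_square_zero_def less_2_cases_iff, presburger+)
  finally show ?case .
qed

lemma jordan_square_zero_rank:
  assumes "2*j \<le> n"
  shows "has_rank n j (jordan_square_zero n j)"
proof (rule has_rank_partial_monomial)
  show "jordan_square_zero n j =
      mat n n (\<lambda>(a,b). \<Sum>i<j. if a = 2*i \<and> b = Suc (2*i) then 1 else 0)"
  proof (rule eq_matI)
    fix a b assume ab: "a < dim_row (mat n n (\<lambda>(a,b). \<Sum>i<j. if a = 2*i \<and> b = Suc (2*i) then 1 else 0 :: complex))"
      "b < dim_col (mat n n (\<lambda>(a,b). \<Sum>i<j. if a = 2*i \<and> b = Suc (2*i) then 1 else 0 :: complex))"
    have "(\<Sum>i<j. if a = 2*i \<and> b = Suc (2*i) then 1 else 0 :: complex)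
        = (\<Sum>i<j. if i = a div 2 then (if even a \<and> b = Suc a then 1 else 0) else 0)"
      by (intro sum.cong) auto
    also have "\<dots> = (if b < 2*j \<and> odd b \<and> Suc a = b then 1 else 0)" by auto
    finally show "jordan_square_zero n j $$ (a,b) =
      mat n n (\<lambda>(a,b). \<Sum>i<j. if a = 2*i \<and> b = Suc (2*i) then 1 else 0) $$ (a,b)"
      using ab by (simp add: jordan_square_zero_def)
  qed (simp_all add: jordan_square_zero_def)
qed (use assms in \<open>auto simp: inj_on_def\<close>)

lemma jordan_square_zero_square: "jordan_square_zero n j * jordan_square_zero n j = 0\<^sub>m n n"
proof (rule eq_matI)
  fix a b assume "a < dim_row (0\<^sub>m n n :: complex mat)" "b < dim_col (0\<^sub>m n n :: complex mat)"
  then show "(jordan_square_zero n j * jordan_square_zero n j) $$ (a,b) = 0\<^sub>m n n $$ (a,b)"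
    by (auto simp: jordan_square_zero_def scalar_prod_def intro!: sum.neutral)
qed (simp_all add: jordan_square_zero_def)

section \<open>Classification of the self-adjoint matrices of square zero\<close>

text \<open>The matrix of an operator in an adapted basis: j diagonal blocks with rows
  \<open>(1, \<i>)\<close> and \<open>(\<i>, -1)\<close>, then zeros.\<close>

definition orthonormal_form :: "nat \<Rightarrow> nat \<Rightarrow> complex mat" where
  "orthonormal_form n j = mat n n (\<lambda>(p,q). if q < 2*j \<and> p div 2 = q div 2
     then (if even p \<and> even q then 1 else if odd p \<and> odd q then -1 else \<i>) else 0)"

lemma less_double_cases:
  fixes p j :: nat
  obtains i where "p = 2*i" "i < j" | i where "p = 2*i+1" "i < j" | "2*j \<le> p"
  by (cases "p < 2*j"; cases "even p") (auto elim!: evenE oddE)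

context odd_dimension
begin

definition p_sq0 :: "complex mat set" where
  "p_sq0 = {x \<in> carrier_mat n n. adj l x = x \<and> x * x = 0\<^sub>m n n}"

text \<open>The bilinear form \<open>u^T J v\<close> in coordinates.\<close>

definition form :: "(nat \<Rightarrow> complex) \<Rightarrow> (nat \<Rightarrow> complex) \<Rightarrow> complex" where
  "form u v = (\<Sum>r<n. (-1)^r * u r * v (2*l-r))"

lemma sum_reflect: "(\<Sum>r<n. f (2*l-r)) = (\<Sum>r<n. f r)"
  by (rule sum.reindex_bij_witness[of _ "\<lambda>r. 2*l-r" "\<lambda>r. 2*l-r"]) (auto simp: n_eq)

lemma reflect_reflect: "r < n \<Longrightarrow> 2*l - (2*l - r) = r"
  by (simp add: n_eq)

interpretation form: bilinear_space n form
proof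
  fix u v w :: "nat \<Rightarrow> complex" and c :: complex and r :: nat
  show "form u v = form v u"
    unfolding form_def by (subst (2) sum_reflect[symmetric])
      (auto simp: reflect_reflect minus_one_power_reflect intro!: sum.cong)
  show "form (\<lambda>r. u r + v r) w = form u w + form v w"
    by (simp add: form_def algebra_simps sum.distrib)
  show "form (\<lambda>r. c * u r) w = c * form u w"
    by (simp add: form_def sum_distrib_left algebra_simps)
  show "form u w = form v w" if "\<And>r. r < n \<Longrightarrow> u r = v r"
    using that by (simp add: form_def)
  show "v r = 0" if "\<And>u. form u v = 0" "r < n"
  proof -
    have "form (\<lambda>s. if s = 2*l - r then 1 else 0) v
        = (\<Sum>s<n. if s = 2*l - r then (-1)^s * v (2*l-s) else 0)"
      unfolding form_def by (intro sum.cong) auto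
    then show ?thesis using that(1)[of "\<lambda>s. if s = 2*l - r then 1 else 0"] that(2)
      by (simp add: reflect_reflect)
  qed
qed

lemma form_uminus: "form (\<lambda>r. - u r) v = - form u v"
  by (simp add: form_def sum_negf)

definition apply_mat :: "complex mat \<Rightarrow> (nat \<Rightarrow> complex) \<Rightarrow> nat \<Rightarrow> complex" where
  "apply_mat x u = (\<lambda>r. if r < n then \<Sum>s<n. x $$ (r,s) * u s else 0)"

lemma square_zero_operator:
  assumes "x \<in> p_sq0"
  shows "square_zero_operator n form (apply_mat x)"
proof
  fix u v :: "nat \<Rightarrow> complex" and c :: complex and r :: nat
  have x: "x \<in> carrier_mat n n" "adj l x = x" "x * x = 0\<^sub>m n n" using assms by (auto simp: p_sq0_def)
  show "apply_mat x (\<lambda>r. u r + v r) = (\<lambda>r. apply_mat x u r + apply_mat x v r)"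
    by (auto simp: apply_mat_def algebra_simps sum.distrib)
  show "apply_mat x (\<lambda>r. c * u r) = (\<lambda>r. c * apply_mat x u r)"
    by (auto simp: apply_mat_def sum_distrib_left algebra_simps)
  show "apply_mat x u r = 0" if "n \<le> r" using that by (simp add: apply_mat_def)
  have "form (apply_mat x u) v = (\<Sum>r<n. \<Sum>s<n. (-1)^r * (x $$ (r,s) * u s) * v (2*l-r))"
    by (simp add: form_def apply_mat_def sum_distrib_left sum_distrib_right)
  also have "\<dots> = (\<Sum>s<n. \<Sum>r<n. (-1)^r * (x $$ (r,s) * u s) * v (2*l-r))" by (rule sum.swap)
  \<comment> \<open>Self-adjointness equates, up to sign, the entries of x at (r,s) and (2l-s,
    2l-r). Reflecting r afterwards restores the product of x and v.\<close>
  also have "\<dots> = (\<Sum>s<n. \<Sum>r<n. (-1)^s * u s * (x $$ (2*l-s,2*l-r) * v (2*l-r)))"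
  proof (intro sum.cong refl)
    fix r s assume "r \<in> {..<n}" "s \<in> {..<n}"
    then have "x $$ (r,s) = (-1)^(r+s) * x $$ (2*l-s,2*l-r)"
      using adj_index[OF x(1), of r s] x(2) by simp
    then have "(-1)^r * (x $$ (r,s) * u s) * v (2*l-r)
        = ((-1)^r * (-1)^(r+s)) * (u s * (x $$ (2*l-s,2*l-r) * v (2*l-r)))"
      by (simp only: mult_ac)
    also have "(-1::complex)^r * (-1)^(r+s) = (-1)^s" by (simp add: minus_one_power_iff)
    finally show "(-1)^r * (x $$ (r,s) * u s) * v (2*l-r)
        = (-1)^s * u s * (x $$ (2*l-s,2*l-r) * v (2*l-r))"
      by (simp only: mult_ac)
  qed
  also have "\<dots> = (\<Sum>s<n. (-1)^s * u s * (\<Sum>r<n. x $$ (2*l-s,r) * v r))"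
    unfolding sum_distrib_left[symmetric]
    by (intro sum.cong refl arg_cong2[of _ _ _ _ "(*)"] sum_reflect)
  also have "\<dots> = form u (apply_mat x v)" by (simp add: form_def apply_mat_def)
  finally show "form (apply_mat x u) v = form u (apply_mat x v)" .
  show "apply_mat x (apply_mat x u) = (\<lambda>r. 0)"
  proof
    fix r
    show "apply_mat x (apply_mat x u) r = 0"
    proof (cases "r < n")
      case True
      have "(\<Sum>s<n. x $$ (r,s) * (\<Sum>k<n. x $$ (s,k) * u k))
          = (\<Sum>k<n. (\<Sum>s<n. x $$ (r,s) * x $$ (s,k)) * u k)"
        unfolding sum_distrib_left sum_distrib_right by (subst sum.swap) (simp add: mult.assoc)
      also have "\<dots> = (\<Sum>k<n. (x * x) $$ (r,k) * u k)"
        using x(1) True by (intro sum.cong) (auto simp: scalar_prod_def lessThan_atLeast0)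
      finally show ?thesis using True by (simp add: apply_mat_def x(3))
    qed (simp add: apply_mat_def)
  qed
qed

lemma basis_mat_product:
  "transpose_mat (mat n n (\<lambda>(r,i). d i r)) * (Jmat l * mat n n (\<lambda>(r,i). c i r))
    = mat n n (\<lambda>(i,k). form (d i) (c k))" (is "?D * (_ * ?C) = _")
proof (rule eq_matI)
  fix i k assume "i < dim_row (mat n n (\<lambda>(i,k). form (d i) (c k)))"
    "k < dim_col (mat n n (\<lambda>(i,k). form (d i) (c k)))"
  then have ik: "i < n" "k < n" by auto
  have "(?D * (Jmat l * ?C)) $$ (i,k) = (\<Sum>r\<in>{0..<n}. ?D $$ (i,r) * (Jmat l * ?C) $$ (r,k))"
    using ik by (simp add: scalar_prod_def)
  also have "\<dots> = (\<Sum>r\<in>{0..<n}. (-1)^r * d i r * c k (2*l-r))"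
  proof (intro sum.cong refl)
    fix r assume "r \<in> {0..<n}"
    then have "(Jmat l * ?C) $$ (r,k) = (-1)^r * ?C $$ (2*l-r,k)"
      using ik by (intro Jmat_mult_index) auto
    then show "?D $$ (i,r) * (Jmat l * ?C) $$ (r,k) = (-1)^r * d i r * c k (2*l-r)"
      using ik \<open>r \<in> {0..<n}\<close> by simp
  qed
  also have "\<dots> = form (d i) (c k)" by (simp add: form_def lessThan_atLeast0)
  finally show "(?D * (Jmat l * ?C)) $$ (i,k) = mat n n (\<lambda>(i,k). form (d i) (c k)) $$ (i,k)"
    using ik by simp
qed (simp_all add: carrier_matD[OF Jmat_carrier])

lemma mult_basis_index:
  assumes "x \<in> carrier_mat n n" "r < n" "i < n"
  shows "(x * mat n n (\<lambda>(r,i). c i r)) $$ (r,i) = apply_mat x (c i) r"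
  using assms by (simp add: apply_mat_def scalar_prod_def lessThan_atLeast0)

text \<open>If d is dual to c for the form, \<open>D J\<close> is the inverse of C, so no inverse
  has to be computed. It applies to an orthonormal basis, which is its own dual, and to a Jordan
  basis with a separate dual.\<close>

lemma dual_basis_similar:
  assumes x: "x \<in> carrier_mat n n" "N \<in> carrier_mat n n"
    and dual: "\<And>p q. p < n \<Longrightarrow> q < n \<Longrightarrow> form (d p) (c q) = (if p = q then 1 else 0)"
    and act: "\<And>q r. q < n \<Longrightarrow> r < n \<Longrightarrow> apply_mat x (c q) r = (\<Sum>p<n. c p r * N $$ (p,q))"
  defines "C \<equiv> mat n n (\<lambda>(r,i). c i r)" and "D \<equiv> transpose_mat (mat n n (\<lambda>(r,i). d i r))"
  shows "D * (Jmat l * C) = 1\<^sub>m n" "x = C * N * (D * Jmat l)"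
proof -
  have [simp]: "C \<in> carrier_mat n n" "D \<in> carrier_mat n n" by (simp_all add: C_def D_def)
  show DC: "D * (Jmat l * C) = 1\<^sub>m n"
    unfolding C_def D_def basis_mat_product by (rule eq_matI) (auto simp: dual)
  have "D * Jmat l * C = 1\<^sub>m n" using DC by (simp add: mult_assoc)
  then have CD: "C * (D * Jmat l) = 1\<^sub>m n" by (rule mat_mult_left_right_inverse[rotated 2]) auto
  have "x * C = C * N"
  proof (rule eq_matI)
    fix r q assume "r < dim_row (C * N)" "q < dim_col (C * N)"
    then have rq: "r < n" "q < n" using x(2) by (simp_all add: C_def)
    have "(x * C) $$ (r,q) = apply_mat x (c q) r"
      unfolding C_def by (rule mult_basis_index[OF x(1) rq])
    also have "\<dots> = (\<Sum>p<n. c p r * N $$ (p,q))" by (rule act) (use rq in auto)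
    also have "\<dots> = (C * N) $$ (r,q)"
      using x(2) rq by (simp add: C_def scalar_prod_def lessThan_atLeast0)
    finally show "(x * C) $$ (r,q) = (C * N) $$ (r,q)" .
  qed (use x in \<open>simp_all add: C_def\<close>)
  then have "C * N * (D * Jmat l) = x * (C * (D * Jmat l))"
    using x mult_assoc[of x C "D * Jmat l"] by simp
  then show "x = C * N * (D * Jmat l)" using CD x by simp
qed

theorem square_zero_classification:
  assumes "x \<in> p_sq0"
  obtains j W where "j \<le> l" "W \<in> carrier_mat n n" "transpose_mat W * (Jmat l * W) = 1\<^sub>m n"
    "x = W * orthonormal_form n j * (transpose_mat W * Jmat l)"
    "similar_mat x (jordan_square_zero n j)"
proof -
  interpret square_zero_operator n form "apply_mat x" by (rule square_zero_operator[OF assms])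
  have x: "x \<in> carrier_mat n n" using assms by (simp add: p_sq0_def)
  obtain j w where j: "2*j \<le> n" and on: "form.orthonormal n w" and ad: "adapted j w"
    and z: "\<And>i. 2*j \<le> i \<Longrightarrow> i < n \<Longrightarrow> apply_mat x (w i) = (\<lambda>r. 0)"
    using exists_adapted_basis by blast
  have w: "form (w a) (w b) = (if a = b then 1 else 0)" if "a < n" "b < n" for a b
    using on that by (simp add: form.orthonormal_def)
  let ?W = "mat n n (\<lambda>(r,i). w i r)"
  have act: "apply_mat x (w q) r = (\<Sum>p<n. w p r * orthonormal_form n j $$ (p,q))"
    if q: "q < n" for q r
  proof (cases "q < 2*j")
    case True
    define i where "i = q div 2"
    have i: "i < j" using True by (auto simp: i_def)
    then have i2: "2*i+1 < n" using j by simp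
    have pi: "p = 2*i \<or> p = 2*i+1" if "p div 2 = q div 2" for p
      using that unfolding i_def by presburger
    have "(\<Sum>p<n. w p r * orthonormal_form n j $$ (p,q))
        = (\<Sum>p\<in>{2*i, 2*i+1}. w p r * orthonormal_form n j $$ (p,q))"
      using i2 q by (intro sum.mono_neutral_right) (auto simp: orthonormal_form_def dest: pi)
    also have "\<dots> = apply_mat x (w q) r"
    proof (cases "even q")
      case True
      then have "q = 2*i" by (simp add: i_def)
      then show ?thesis
        using i i2 ad by (simp add: adapted_def orthonormal_form_def)
    next
      case False
      then have "q = 2*i+1" by (simp add: i_def)
      then show ?thesis
        using i i2 ad by (simp add: adapted_def orthonormal_form_def)
    qed
    finally show ?thesis by simp
  next
    case False
    then show ?thesis using q z[of q] by (simp add: orthonormal_form_def)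
  qed
  have 1: "transpose_mat ?W * (Jmat l * ?W) = 1\<^sub>m n"
    "x = ?W * orthonormal_form n j * (transpose_mat ?W * Jmat l)"
    using dual_basis_similar[OF x _ w act] by (simp_all add: orthonormal_form_def)
  \<comment> \<open>A Jordan basis: for even q the pair is \<open>X (w q)\<close>,
    \<open>w q\<close>, so X sends the second vector to the first and the first to zero. The vectors
    d solve the duality equations on the same plane.\<close>
  define c where "c q = (if q < 2*j then if even q then (\<lambda>r. w q r + \<i> * w (q+1) r)
    else w (q-1) else w q)" for q
  define d where "d q = (if q < 2*j then if even q then (\<lambda>r. (-\<i>) * w (q+1) r)
    else (\<lambda>r. w (q-1) r + \<i> * w q r) else w q)" for q
  have dual: "form (d p) (c q) = (if p = q then 1 else 0)" if "p < n" "q < n" for p q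
    by (rule less_double_cases[of p j]; rule less_double_cases[of q j])
      (use that j in \<open>simp_all add: c_def d_def form.B_linear form_uminus w
        Suc_double_not_eq_double double_not_eq_Suc_double\<close>)
  have actc: "apply_mat x (c q) r = (\<Sum>p<n. c p r * jordan_square_zero n j $$ (p,q))"
    if q: "q < n" for q r
  proof (cases "q < 2*j \<and> odd q")
    case True
    then obtain i where i: "q = 2*i+1" "i < j" by (auto elim!: oddE)
    have "(\<Sum>p<n. c p r * jordan_square_zero n j $$ (p,q)) = (\<Sum>p<n. if p = 2*i then c p r else 0)"
      using i q by (intro sum.cong) (auto simp: jordan_square_zero_def)
    also have "\<dots> = apply_mat x (c q) r" using i q ad by (simp add: c_def adapted_def)
    finally show ?thesis by simp
  next
    case False
    then have "(\<Sum>p<n. c p r * jordan_square_zero n j $$ (p,q)) = 0"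
      using q by (intro sum.neutral) (auto simp: jordan_square_zero_def)
    also have "\<dots> = apply_mat x (c q) r"
    proof (cases "q < 2*j")
      case True
      with False obtain i where i: "q = 2*i" "i < j" by (auto elim!: evenE)
      then show ?thesis using ad by (simp add: c_def X_add X_scale adapted_def algebra_simps)
    next
      case False
      then show ?thesis using z[OF _ q] by (simp add: c_def)
    qed
    finally show ?thesis by simp
  qed
  let ?C = "mat n n (\<lambda>(r,i). c i r)" and ?D = "transpose_mat (mat n n (\<lambda>(r,i). d i r))"
  have J: "jordan_square_zero n j \<in> carrier_mat n n" by (simp add: jordan_square_zero_def)
  have CD: "?D * Jmat l * ?C = 1\<^sub>m n" "x = ?C * jordan_square_zero n j * (?D * Jmat l)"
    using dual_basis_similar[OF x J dual actc] by (simp_all add: mult_assoc)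
  have "similar_mat x (jordan_square_zero n j)"
  proof (rule similar_matI)
    show "?C * (?D * Jmat l) = 1\<^sub>m n" using CD(1) by (rule mat_mult_left_right_inverse[rotated 2]) auto
  qed (use CD x J in auto)
  moreover have "j \<le> l" "?W \<in> carrier_mat n n" using j n_eq by simp_all
  ultimately show ?thesis using that[OF _ _ 1] by blast
qed

end

section \<open>Orbits of K on the self-adjoint matrices of square zero\<close>

lemma trace_mult_commute:
  fixes A B :: "'a::comm_semiring_0 mat"
  assumes "A \<in> carrier_mat n n" "B \<in> carrier_mat n n"
  shows "(\<Sum>i<n. (A * B) $$ (i,i)) = (\<Sum>i<n. (B * A) $$ (i,i))"
proof -
  have "(\<Sum>i<n. (A * B) $$ (i,i)) = (\<Sum>i<n. \<Sum>k<n. A $$ (i,k) * B $$ (k,i))"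
    using assms by (intro sum.cong) (auto simp: scalar_prod_def lessThan_atLeast0)
  also have "\<dots> = (\<Sum>k<n. \<Sum>i<n. A $$ (i,k) * B $$ (k,i))" by (rule sum.swap)
  also have "\<dots> = (\<Sum>i<n. (B * A) $$ (i,i))"
    using assms by (intro sum.cong) (auto simp: scalar_prod_def lessThan_atLeast0 mult.commute)
  finally show ?thesis .
qed

context odd_dimension
begin

lemmas one_mat_simps [simp] = left_mult_one_mat[of _ n n] right_mult_one_mat[of _ n n]
  left_mult_zero_mat[of _ n n n] right_mult_zero_mat[of _ n n n]

text \<open>The first j rows of J with all other rows zero. The adjoint reflects a matrix in the
  antidiagonal, so a matrix supported there is self-adjoint; for \<open>j \<le> l\<close> it is also
  strictly upper triangular.\<close>

definition std :: "nat \<Rightarrow> complex mat" where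
  "std j = mat n n (\<lambda>(p,q). if p < j \<and> p + q = 2*l then (-1)^p else 0)"

lemma std_carrier [simp]: "std j \<in> carrier_mat n n"
  by (simp add: std_def)

lemma std_index: "p < n \<Longrightarrow> q < n \<Longrightarrow> std j $$ (p,q) = (if p < j \<and> p + q = 2*l then (-1)^p else 0)"
  by (simp add: std_def)

lemma std_p_sq0:
  assumes "j \<le> l"
  shows "std j \<in> p_sq0"
  unfolding p_sq0_def
proof (intro CollectI conjI std_carrier)
  show "adj l (std j) = std j"
  proof (rule eq_matI)
    fix i k assume "i < dim_row (std j)" "k < dim_col (std j)"
    then have ik: "i < n" "k < n" by (auto simp: std_def)
    have "(2*l - k < j \<and> 2*l - k + (2*l - i) = 2*l) = (i < j \<and> i + k = 2*l)"
      using ik assms n_eq by auto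
    moreover have "2*l - k = i" if "i + k = 2*l" using that by simp
    moreover have "(-1::complex)^(i+k) * (-1)^(2*l-k) = (-1)^i"
      using ik by (simp add: n_eq minus_one_power_iff)
    ultimately show "adj l (std j) $$ (i,k) = std j $$ (i,k)"
      using ik by (auto simp: adj_index[OF std_carrier] std_index)
  qed (simp_all add: std_def)
  show "std j * std j = 0\<^sub>m n n"
  proof (rule eq_matI)
    fix i k assume "i < dim_row (0\<^sub>m n n :: complex mat)" "k < dim_col (0\<^sub>m n n :: complex mat)"
    then have ik: "i < n" "k < n" by auto
    have "(std j * std j) $$ (i,k) = (\<Sum>r\<in>{0..<n}. std j $$ (i,r) * std j $$ (r,k))"
      using ik by (simp add: scalar_prod_def carrier_matD[OF std_carrier])
    also have "\<dots> = 0"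
      using assms ik by (intro sum.neutral) (auto simp: std_index)
    finally show "(std j * std j) $$ (i,k) = 0\<^sub>m n n $$ (i,k)" using ik by simp
  qed (simp_all add: std_def)
qed

lemma std_rank:
  assumes "j \<le> l"
  shows "has_rank n j (std j)"
proof (rule has_rank_partial_monomial)
  show "std j = mat n n (\<lambda>(a,b). \<Sum>i<j. if a = i \<and> b = 2*l - i then (-1)^i else 0)"
  proof (rule eq_matI)
    fix a b
    assume "a < dim_row (mat n n (\<lambda>(a,b). \<Sum>i<j. if a = i \<and> b = 2*l - i then (-1)^i else 0 :: complex))"
      "b < dim_col (mat n n (\<lambda>(a,b). \<Sum>i<j. if a = i \<and> b = 2*l - i then (-1)^i else 0 :: complex))"
    then have ab: "a < n" "b < n" by auto
    have "(\<Sum>i<j. if a = i \<and> b = 2*l - i then (-1)^i else 0 :: complex)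
        = (\<Sum>i<j. if i = a then if b = 2*l - a then (-1)^a else 0 else 0)"
      by (intro sum.cong) auto
    also have "\<dots> = (if a < j \<and> a + b = 2*l then (-1)^a else 0)" using assms by auto
    finally show "std j $$ (a,b) =
        mat n n (\<lambda>(a,b). \<Sum>i<j. if a = i \<and> b = 2*l - i then (-1)^i else 0) $$ (a,b)"
      using ab by (simp add: std_index)
  qed (simp_all add: std_def)
  show "inj_on (\<lambda>i. 2*l - i) {..<j}" using assms by (auto simp: inj_on_def)
qed (use assms in \<open>auto simp: n_eq\<close>)

lemma p_sq0_carrier: "x \<in> p_sq0 \<Longrightarrow> x \<in> carrier_mat n n"
  by (simp add: p_sq0_def)

lemma jordan_square_zero_carrier: "jordan_square_zero n j \<in> carrier_mat n n"
  by (simp add: jordan_square_zero_def)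

text \<open>The number of blocks is tied to the given rank by similarity invariance and uniqueness
  of the rank.\<close>

lemma p_sq0_classification:
  assumes "x \<in> p_sq0" "has_rank n j x"
  shows "j \<le> l \<and> similar_mat x (jordan_square_zero n j) \<and>
    (\<exists>W. W \<in> carrier_mat n n \<and> transpose_mat W * (Jmat l * W) = 1\<^sub>m n \<and>
      x = W * orthonormal_form n j * (transpose_mat W * Jmat l))"
proof -
  obtain i W where i: "i \<le> l" "W \<in> carrier_mat n n" "transpose_mat W * (Jmat l * W) = 1\<^sub>m n"
    "x = W * orthonormal_form n i * (transpose_mat W * Jmat l)"
    "similar_mat x (jordan_square_zero n i)"
    using square_zero_classification[OF assms(1)] .
  have "has_rank n i x"
    using has_rank_similar[OF i(5) jordan_square_zero_carrier] jordan_square_zero_rank i(1) n_eq by simp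
  then have "i = j" using has_rank_unique assms(2) by blast
  then show ?thesis using i by blast
qed

lemma p_sq0_rank_exists:
  assumes "x \<in> p_sq0"
  obtains j where "j \<le> l" "has_rank n j x"
proof -
  obtain i where i: "i \<le> l" "similar_mat x (jordan_square_zero n i)"
    using square_zero_classification[OF assms] by blast
  then have "has_rank n i x"
    using has_rank_similar[OF i(2) jordan_square_zero_carrier] jordan_square_zero_rank n_eq by simp
  then show ?thesis using that i by blast
qed

lemma Kgrp_inverse:
  assumes "k \<in> Kgrp l"
  shows "k \<in> carrier_mat n n" "k * adj l k = 1\<^sub>m n" "adj l k * k = 1\<^sub>m n" "minv k = adj l k"
proof -
  show k: "k \<in> carrier_mat n n" "k * adj l k = 1\<^sub>m n" using assms by (auto simp: Kgrp_iff)
  then show "minv k = adj l k" by (intro minv_eqI[of _ n]) auto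
  show "adj l k * k = 1\<^sub>m n" by (rule mat_mult_left_right_inverse[OF k(1) _ k(2)]) (simp add: k)
qed

lemma adj_uminus: "A \<in> carrier_mat n n \<Longrightarrow> adj l (- A) = - adj l A"
  by (rule eq_matI) (auto simp: adj_index)

lemma p_sq0_conjugate:
  assumes x: "x \<in> p_sq0" "has_rank n j x" and y: "y \<in> p_sq0" "has_rank n j y"
  obtains k where "k \<in> Kgrp l" "x = k * y * adj l k"
proof -
  let ?J = "Jmat l :: complex mat"
  obtain W where W [simp]: "W \<in> carrier_mat n n" and WJW: "transpose_mat W * (?J * W) = 1\<^sub>m n"
    and xW: "x = W * orthonormal_form n j * (transpose_mat W * ?J)"
    using p_sq0_classification[OF x] by blast
  obtain V where V [simp]: "V \<in> carrier_mat n n" and VJV: "transpose_mat V * (?J * V) = 1\<^sub>m n"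
    and yV: "y = V * orthonormal_form n j * (transpose_mat V * ?J)"
    using p_sq0_classification[OF y] by blast
  have N [simp]: "orthonormal_form n j \<in> carrier_mat n n" by (simp add: orthonormal_form_def)
  have cancelV: "transpose_mat V * (?J * (V * A)) = A" if "A \<in> carrier_mat n n" for A
  proof -
    have "transpose_mat V * (?J * (V * A)) = transpose_mat V * (?J * V) * A"
      using that by (simp add: mult_assoc)
    then show ?thesis using that by (simp add: VJV)
  qed
  have WWJ: "W * (transpose_mat W * ?J) = 1\<^sub>m n"
    by (rule mat_mult_left_right_inverse[rotated 2]) (use WJW in \<open>simp_all add: mult_assoc\<close>)
  \<comment> \<open>The inverse of V is \<open>V^T J\<close>, so k carries the adapted basis V of y
    to the adapted basis W of x.\<close>
  define k where "k = W * (transpose_mat V * ?J)"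
  have k [simp]: "k \<in> carrier_mat n n" by (simp add: k_def)
  have adjk: "adj l k = V * (transpose_mat W * ?J)"
    by (simp add: k_def adj_def transpose_mult[of _ n n _ n] Jmat_transpose mult_assoc
        Jmat_cancel[where m = n])
  have k1: "k * adj l k = 1\<^sub>m n"
    unfolding adjk by (simp add: k_def mult_assoc cancelV WWJ)
  have xk: "x = k * y * adj l k"
    unfolding adjk by (simp add: k_def yV xW mult_assoc cancelV)
  have detk: "det k * det k = 1"
  proof -
    have "det (adj l k) = det ?J * det k * det ?J"
      by (simp add: adj_def det_mult[of _ n] det_transpose[OF k])
    moreover have "det ?J * det ?J = 1" by (simp flip: det_mult[of _ n] add: Jmat_square)
    moreover have "det k * det (adj l k) = 1" by (simp flip: det_mult[of _ n] add: k1)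
    ultimately show ?thesis by (simp add: mult_ac)
  qed
  show ?thesis
  proof (cases "det k = 1")
    case True
    then have "k \<in> Kgrp l" using k1 by (simp add: Kgrp_iff)
    then show ?thesis using that xk by blast
  next
    \<comment> \<open>Here n is odd: -k has determinant 1, is still an isometry, and conjugates y in
      the same way.\<close>
    case False
    then have "det k = -1" using detk by (metis square_eq_1_iff)
    moreover have "- k = (-1) \<cdot>\<^sub>m k" by (rule eq_matI) auto
    ultimately have "det (- k) = 1" using k n_eq by (simp add: carrier_matD)
    moreover have "- k * adj l (- k) = 1\<^sub>m n" using k1
      by (simp add: adj_uminus uminus_mult_left_mat uminus_mult_right_mat carrier_matD[OF k])
    moreover have "x = - k * y * adj l (- k)"
      using xk carrier_matD[OF p_sq0_carrier[OF y(1)]]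
      by (simp add: adj_uminus uminus_mult_left_mat uminus_mult_right_mat carrier_matD[OF k])
    moreover have "- k \<in> carrier_mat n n" by simp
    ultimately show ?thesis using that[of "- k"] Kgrp_iff by blast
  qed
qed

lemma p_sq0_conjugate_std:
  assumes "x \<in> p_sq0" "has_rank n j x"
  obtains k where "j \<le> l" "k \<in> Kgrp l" "x = k * std j * adj l k"
proof -
  have "j \<le> l" using p_sq0_classification[OF assms] by blast
  then show ?thesis using p_sq0_conjugate[OF assms std_p_sq0 std_rank] that by blast
qed

lemma conjugate_p_sq0:
  assumes k: "k \<in> Kgrp l" and x: "x \<in> p_sq0"
  shows "k * x * adj l k \<in> p_sq0"
proof -
  have [simp]: "k \<in> carrier_mat n n" "x \<in> carrier_mat n n"
    and kk: "adj l k * k = 1\<^sub>m n" and x': "adj l x = x" "x * x = 0\<^sub>m n n"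
    using Kgrp_inverse[OF k] x by (auto simp: p_sq0_def)
  have "adj l k * (k * (x * adj l k)) = x * adj l k"
    using mult_assoc[of "adj l k" k "x * adj l k"] by (simp add: kk)
  moreover have "x * (x * adj l k) = 0\<^sub>m n n"
    using mult_assoc[of x x "adj l k"] by (simp add: x')
  ultimately have "k * x * adj l k * (k * x * adj l k) = 0\<^sub>m n n"
    by (simp add: mult_assoc)
  then show ?thesis
    by (simp add: p_sq0_def adj_mult adj_adj x' mult_assoc)
qed

lemma conjugate_rank:
  assumes k: "k \<in> Kgrp l" and x: "has_rank n j x"
  shows "has_rank n j (k * x * adj l k)"
  using has_rank_mult[OF x, of k "adj l k" "adj l k" k] Kgrp_inverse[OF k] by simp

text \<open>The trace is invariant under similarity, and the Jordan matrix has zero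
  diagonal.\<close>

lemma p_sq0_subset_Np2: "p_sq0 \<subseteq> Np2 l"
proof
  fix x assume x: "x \<in> p_sq0"
  then have x': "x \<in> carrier_mat n n" "adj l x = x" "x * x = 0\<^sub>m n n" by (auto simp: p_sq0_def)
  obtain j where j: "similar_mat x (jordan_square_zero n j)"
    using square_zero_classification[OF x] by blast
  let ?N = "jordan_square_zero n j"
  obtain P R where P: "P \<in> carrier_mat n n" "R \<in> carrier_mat n n" "R * P = 1\<^sub>m n" "x = P * ?N * R"
    using similar_matD[OF j] x'(1) by auto
  have "(\<Sum>i<n. x $$ (i,i)) = (\<Sum>i<n. (R * (P * ?N)) $$ (i,i))"
    unfolding P(4) using P jordan_square_zero_carrier by (intro trace_mult_commute) auto
  also have "R * (P * ?N) = ?N"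
    using mult_assoc[OF P(2,1) jordan_square_zero_carrier] P(3)
    by (simp add: left_mult_one_mat[OF jordan_square_zero_carrier])
  also have "(\<Sum>i<n. ?N $$ (i,i)) = 0" by (simp add: jordan_square_zero_def)
  finally have "x \<in> pspace l" using x' by (simp add: pspace_iff)
  moreover have "x ^\<^sub>m 2 = 0\<^sub>m n n" using x' by (simp add: numeral_2_eq_2)
  ultimately show "x \<in> Np2 l"
    unfolding Np2_def Np_def n_eq[symmetric] using x'(3) by blast
qed

lemma Np2_eq: "Np2 l = p_sq0"
  using p_sq0_subset_Np2 unfolding Np2_def Np_def pspace_iff p_sq0_def n_eq[symmetric] by blast

text \<open>Among square zero matrices the number of Jordan blocks of size 2 is the rank.\<close>

lemma nilp_type_eq:
  assumes "j \<le> l"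
  shows "nilp_type l j = {x \<in> p_sq0. has_rank n j x}"
proof -
  have n: "2*j + (2*l + 1 - 2*j) = n" using assms n_eq by simp
  have nf: "jordan_nf x (replicate j (2,0) @ replicate (2*l+1-2*j) (1,0))
      \<longleftrightarrow> similar_mat x (jordan_square_zero n j)" for x :: "complex mat"
    unfolding jordan_nf_def jordan_matrix_square_zero n by auto
  show ?thesis
  proof (intro subset_antisym subsetI)
    fix x assume "x \<in> nilp_type l j"
    then have x: "x \<in> pspace l" "similar_mat x (jordan_square_zero n j)"
      unfolding nilp_type_def nf by (auto simp: Np_def)
    then have x': "x \<in> carrier_mat n n" "adj l x = x" by (auto simp: pspace_iff)
    obtain P R where P: "similar_mat_wit x (jordan_square_zero n j) P R"
      using x(2) unfolding similar_mat_def by blast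
    have "x ^\<^sub>m 2 = P * jordan_square_zero n j ^\<^sub>m 2 * R" by (rule similar_mat_wit_pow_id[OF P])
    moreover have "P \<in> carrier_mat n n" "R \<in> carrier_mat n n"
      using P x'(1) by (auto simp: similar_mat_wit_def Let_def)
    ultimately have "x * x = 0\<^sub>m n n"
      using x'(1) jordan_square_zero_square jordan_square_zero_carrier
      by (simp add: numeral_2_eq_2 jordan_square_zero_def)
    moreover have "has_rank n j x"
      using has_rank_similar[OF x(2) jordan_square_zero_carrier] jordan_square_zero_rank assms n_eq
      by simp
    ultimately show "x \<in> {x \<in> p_sq0. has_rank n j x}" using x' by (simp add: p_sq0_def)
  next
    fix x assume "x \<in> {x \<in> p_sq0. has_rank n j x}"
    then show "x \<in> nilp_type l j"
      unfolding nilp_type_def nf using p_sq0_classification Np2_eq by (auto simp: Np2_def)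
  qed
qed

text \<open>Justifies treating a set given by Jordan type as a single K-orbit, with
  \<open>std j\<close> as base point.\<close>

lemma nilp_type_orbit:
  assumes "j \<le> l"
  shows "std j \<in> Np l" "nilp_type l j = K_orbit l (std j)"
proof -
  show "std j \<in> Np l" using std_p_sq0[OF assms] Np2_eq by (auto simp: Np2_def)
  show "nilp_type l j = K_orbit l (std j)"
  proof (intro subset_antisym subsetI)
    fix x assume "x \<in> nilp_type l j"
    then obtain k where "k \<in> Kgrp l" "x = k * std j * adj l k"
      using p_sq0_conjugate_std nilp_type_eq[OF assms] by blast
    then have "x = k * std j * minv k" using Kgrp_inverse(4) by simp
    then show "x \<in> K_orbit l (std j)" using \<open>k \<in> Kgrp l\<close> unfolding K_orbit_def by blast
  next
    fix x assume "x \<in> K_orbit l (std j)"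
    then obtain k where "k \<in> Kgrp l" "x = k * std j * adj l k"
      using Kgrp_inverse(4) by (auto simp: K_orbit_def)
    then show "x \<in> nilp_type l j"
      using conjugate_p_sq0 std_p_sq0[OF assms] conjugate_rank std_rank[OF assms] nilp_type_eq[OF assms]
      by blast
  qed
qed

end

section \<open>Fixed points over Laurent series\<close>

definition tw :: "complex fls \<Rightarrow> complex fls" where
  "tw f = fls_compose_fps f (- fps_X)"

lemma tw_nth: "fls_nth (tw f) k = fls_nth f k * (-1) powi k"
proof -
  have eq: "- fps_X = fps_const (-1) * (fps_X :: complex fps)" by simp
  show ?thesis unfolding tw_def eq by (rule fls_nth_fls_compose_fps_linear) simp
qed

interpretation tw: comm_ring_hom tw
  by unfold_locales (simp_all add: tw_def fls_compose_fps_add fls_compose_fps_mult)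

interpretation fls_const: comm_ring_hom "fls_const :: complex \<Rightarrow> complex fls"
  by unfold_locales (simp_all add: fls_plus_const)

lemma tw_tw: "tw (tw f) = f"
proof (rule fls_eqI)
  fix k :: int
  have "(-1::complex) powi k * (-1) powi k = 1"
    by (simp flip: power_int_mult_distrib)
  then show "fls_nth (tw (tw f)) k = fls_nth f k" by (simp add: tw_nth mult.assoc)
qed

text \<open>The finite range of the convolution may miss the index m; then m lies below one of the
  two subdegrees and the claimed product is zero as well.\<close>

lemma fls_times_nth_single:
  fixes f g :: "complex fls"
  assumes "\<And>i. i \<noteq> m \<Longrightarrow> fls_nth f i * fls_nth g (k - i) = 0"
  shows "fls_nth (f * g) k = fls_nth f m * fls_nth g (k - m)"
proof -
  let ?I = "{fls_subdegree f..k - fls_subdegree g}"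
  have "fls_nth (f * g) k = (\<Sum>i\<in>?I. if i = m then fls_nth f m * fls_nth g (k - m) else 0)"
    unfolding fls_times_nth(2) using assms by (intro sum.cong) auto
  also have "\<dots> = (if m \<in> ?I then fls_nth f m * fls_nth g (k - m) else 0)" by simp
  also have "\<dots> = fls_nth f m * fls_nth g (k - m)"
  proof (cases "m \<in> ?I")
    case False
    then have "m < fls_subdegree f \<or> k - m < fls_subdegree g" by auto
    then show ?thesis by auto
  qed simp
  finally show ?thesis .
qed

text \<open>Because all constants belong to the set, it is an algebra over the complex numbers, and
  signs and negatives come from multiplication by -1.\<close>

definition stable_subring :: "complex fls set \<Rightarrow> bool" where
  "stable_subring S \<longleftrightarrow> range fls_const \<subseteq> S \<and>
     (\<forall>f\<in>S. tw f \<in> S \<and> (\<forall>g\<in>S. f + g \<in> S \<and> f * g \<in> S))"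

lemma stable_subringD:
  assumes "stable_subring S"
  shows "fls_const c \<in> S" "f \<in> S \<Longrightarrow> tw f \<in> S" "f \<in> S \<Longrightarrow> g \<in> S \<Longrightarrow> f + g \<in> S"
    "f \<in> S \<Longrightarrow> g \<in> S \<Longrightarrow> f * g \<in> S"
  using assms by (auto simp: stable_subring_def)

lemma stable_subring_sum:
  assumes "stable_subring S" "\<And>i. i \<in> I \<Longrightarrow> f i \<in> S"
  shows "(\<Sum>i\<in>I. f i) \<in> S"
  using assms(2) stable_subringD(1)[OF assms(1), of 0]
  by (induction I rule: infinite_finite_induct) (auto intro: stable_subringD[OF assms(1)])

lemma stable_UNIV: "stable_subring UNIV"
  by (simp add: stable_subring_def)

lemma fls_O_times:
  assumes "f \<in> fls_O" "g \<in> fls_O"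
  shows "f * g \<in> fls_O" "fls_nth (f * g) 0 = fls_nth f 0 * fls_nth g 0"
proof -
  have *: "fls_nth f i * fls_nth g (k - i) = 0" if "k < 0 \<or> k = 0 \<and> i \<noteq> 0" for i k
    using assms that by (cases "i < 0") (auto simp: fls_O_def)
  have "fls_nth (f * g) k = 0" if "k < 0" for k
  proof -
    have "fls_nth (f * g) k = fls_nth f 0 * fls_nth g (k - 0)"
      by (intro fls_times_nth_single *) (use that in simp)
    also have "\<dots> = 0" by (rule *) (use that in simp)
    finally show ?thesis .
  qed
  then show "f * g \<in> fls_O" by (simp add: fls_O_def)
  show "fls_nth (f * g) 0 = fls_nth f 0 * fls_nth g 0"
    using fls_times_nth_single[of 0 f g 0] *[of 0] by simp
qed

lemma fls_O_minus_times:
  assumes "f \<in> fls_O_minus" "g \<in> fls_O_minus"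
  shows "f * g \<in> fls_O_minus" "fls_nth (f * g) 0 = fls_nth f 0 * fls_nth g 0"
proof -
  have *: "fls_nth f i * fls_nth g (k - i) = 0" if "k > 0 \<or> k = 0 \<and> i \<noteq> 0" for i k
    using assms that by (cases "i > 0") (auto simp: fls_O_minus_def)
  have "fls_nth (f * g) k = 0" if "k > 0" for k
  proof -
    have "fls_nth (f * g) k = fls_nth f 0 * fls_nth g (k - 0)"
      by (intro fls_times_nth_single *) (use that in simp)
    also have "\<dots> = 0" by (rule *) (use that in simp)
    finally show ?thesis .
  qed
  then show "f * g \<in> fls_O_minus" by (simp add: fls_O_minus_def)
  show "fls_nth (f * g) 0 = fls_nth f 0 * fls_nth g 0"
    using fls_times_nth_single[of 0 f g 0] *[of 0] by simp
qed

lemma stable_O: "stable_subring fls_O"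
proof -
  have "fls_const c \<in> fls_O" "f \<in> fls_O \<Longrightarrow> tw f \<in> fls_O"
    "f \<in> fls_O \<Longrightarrow> g \<in> fls_O \<Longrightarrow> f + g \<in> fls_O" for c f g
    by (auto simp: fls_O_def tw_nth)
  then show ?thesis by (auto simp: stable_subring_def fls_O_times)
qed

lemma stable_O_minus: "stable_subring fls_O_minus"
proof -
  have "fls_const c \<in> fls_O_minus" "f \<in> fls_O_minus \<Longrightarrow> tw f \<in> fls_O_minus"
    "f \<in> fls_O_minus \<Longrightarrow> g \<in> fls_O_minus \<Longrightarrow> f + g \<in> fls_O_minus" for c f g
    by (auto simp: fls_O_minus_def tw_nth)
  then show ?thesis by (auto simp: stable_subring_def fls_O_minus_times)
qed

text \<open>The coefficient of \<open>t\<^sup>0\<close>: evaluation at \<open>t = 0\<close> on \<open>\<O>\<close>, but evaluation at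
  \<open>t = \<infinity>\<close> on \<open>\<O>\<^sup>-\<close>. It is multiplicative on either ring, not on \<open>\<K>\<close>.\<close>

definition ev0 :: "complex fls mat \<Rightarrow> complex mat" where
  "ev0 A = map_mat (\<lambda>f. fls_nth f 0) A"

text \<open>The common ground of the two evaluations, at 0 and at infinity, so that each argument
  about \<open>ev0\<close> serves both rings.\<close>

definition evaluable :: "complex fls set \<Rightarrow> bool" where
  "evaluable S \<longleftrightarrow> stable_subring S \<and>
     (\<forall>f\<in>S. \<forall>g\<in>S. fls_nth (f * g) 0 = fls_nth f 0 * fls_nth g 0)"

lemma evaluable_O: "evaluable fls_O" and evaluable_O_minus: "evaluable fls_O_minus"
  by (simp_all add: evaluable_def stable_O stable_O_minus fls_O_times fls_O_minus_times)

lemma elements_mat_iff: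
  "A \<in> carrier_mat n m \<Longrightarrow> elements_mat A \<subseteq> S \<longleftrightarrow> (\<forall>i<n. \<forall>j<m. A $$ (i,j) \<in> S)"
  by (auto dest!: elements_matD intro: elements_matI)

lemma stable_mat_mult:
  assumes "stable_subring S" "A \<in> carrier_mat n n" "B \<in> carrier_mat n n"
    "elements_mat A \<subseteq> S" "elements_mat B \<subseteq> S"
  shows "elements_mat (A * B) \<subseteq> S"
  using assms
  by (auto simp: elements_mat_iff[of _ n n] scalar_prod_def mult_carrier_mat[of _ n n _ n]
      intro!: stable_subring_sum stable_subringD(4))

lemma ev0_carrier [simp]: "ev0 A \<in> carrier_mat n m \<longleftrightarrow> A \<in> carrier_mat n m"
  by (simp add: ev0_def)

lemma ev0_mult:
  assumes S: "evaluable S" and A: "A \<in> carrier_mat n n" and B: "B \<in> carrier_mat n n"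
    and el: "elements_mat A \<subseteq> S" "elements_mat B \<subseteq> S"
  shows "ev0 (A * B) = ev0 A * ev0 B"
proof (rule eq_matI)
  fix i j assume "i < dim_row (ev0 A * ev0 B)" "j < dim_col (ev0 A * ev0 B)"
  then have ij: "i < n" "j < n" using A B by (auto simp: ev0_def)
  then show "ev0 (A * B) $$ (i,j) = (ev0 A * ev0 B) $$ (i,j)"
    using A B el S
    by (auto simp: ev0_def scalar_prod_def fls_nth_sum evaluable_def elements_mat_iff[of _ n n]
        intro!: sum.cong)
qed (use A B in \<open>auto simp: ev0_def\<close>)

text \<open>\<open>ev0\<close> is not a ring homomorphism on all Laurent series, so the determinants
  are compared through the Leibniz expansion, whose products all stay in S.\<close>

lemma ev0_det:
  assumes S: "evaluable S" and A: "A \<in> carrier_mat n n" and el: "elements_mat A \<subseteq> S"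
  shows "det (ev0 A) = fls_nth (det A) 0"
proof -
  have st: "stable_subring S" using S by (simp add: evaluable_def)
  have prod: "(\<Prod>i\<in>I. f i) \<in> S \<and> fls_nth (\<Prod>i\<in>I. f i) 0 = (\<Prod>i\<in>I. fls_nth (f i) 0)"
    if "\<And>i. i \<in> I \<Longrightarrow> f i \<in> S" for I :: "nat set" and f
    using that stable_subringD(1)[OF st, of 1]
    by (induction I rule: infinite_finite_induct)
      (use S stable_subringD(4)[OF st] in \<open>auto simp: evaluable_def\<close>)
  have sg: "fls_nth (signof p * f) 0 = signof p * fls_nth f 0" for p and f :: "complex fls"
    by (simp add: sign_def)
  have "fls_nth (det A) 0 = (\<Sum>p\<in>{p. p permutes {0..<n}}.
      signof p * fls_nth (\<Prod>i=0..<n. A $$ (i, p i)) 0)"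
    unfolding det_def'[OF A] fls_nth_sum sg ..
  also have "\<dots> = (\<Sum>p\<in>{p. p permutes {0..<n}}. signof p * (\<Prod>i=0..<n. ev0 A $$ (i, p i)))"
  proof (rule sum.cong[OF refl])
    fix p assume "p \<in> {p. p permutes {0..<n}}"
    then have p: "p i < n" if "i < n" for i using that permutes_in_image by fastforce
    have "fls_nth (\<Prod>i=0..<n. A $$ (i, p i)) 0 = (\<Prod>i=0..<n. fls_nth (A $$ (i, p i)) 0)"
      using p el A by (intro prod[THEN conjunct2]) (auto simp: elements_mat_iff)
    also have "\<dots> = (\<Prod>i=0..<n. ev0 A $$ (i, p i))"
      using p A by (intro prod.cong) (auto simp: ev0_def)
    finally show "signof p * fls_nth (\<Prod>i=0..<n. A $$ (i, p i)) 0
        = signof p * (\<Prod>i=0..<n. ev0 A $$ (i, p i))" by simp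
  qed
  also have "\<dots> = det (ev0 A)" using A by (intro det_def'[symmetric]) simp
  finally show ?thesis by simp
qed

context odd_dimension
begin

lemma adj_hom:
  assumes "comm_ring_hom h" "A \<in> carrier_mat n n"
  shows "adj l (map_mat h A) = map_mat h (adj l A)"
proof -
  interpret comm_ring_hom h by (rule assms)
  have sign: "h ((-1) ^ k * c) = (-1) ^ k * h c" for k c
    by (simp add: hom_distribs)
  show ?thesis
    by (rule eq_matI) (use assms(2) in \<open>auto simp: adj_index sign\<close>)
qed

text \<open>An involution reversing products, which on the fixed group of \<open>sigma\<close> is
  inversion. It supplies inverses with visible entries.\<close>

definition tstar :: "complex fls mat \<Rightarrow> complex fls mat" where
  "tstar A = adj l (map_mat tw A)"

lemma tstar_carrier [simp]: "A \<in> carrier_mat n n \<Longrightarrow> tstar A \<in> carrier_mat n n"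
  by (simp add: tstar_def)

lemma tstar_mult:
  "A \<in> carrier_mat n n \<Longrightarrow> B \<in> carrier_mat n n \<Longrightarrow> tstar (A * B) = tstar B * tstar A"
  by (simp add: tstar_def tw.mat_hom_mult[of _ n n _ n] adj_mult)

lemma map_tw_tw: "map_mat tw (map_mat tw A) = A"
  by (rule eq_matI) (simp_all add: tw_tw)

lemma tstar_tstar: "A \<in> carrier_mat n n \<Longrightarrow> tstar (tstar A) = A"
  by (simp add: tstar_def adj_adj map_tw_tw flip: adj_hom[OF tw.comm_ring_hom_axioms])

lemma sigma_fixed_iff:
  assumes "A \<in> SL n"
  shows "sigma l A = A \<longleftrightarrow> A * tstar A = 1\<^sub>m n"
proof -
  have A: "A \<in> carrier_mat n n" "det A = 1" using assms by (auto simp: SL_def)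
  let ?A = "map_mat tw A"
  have "?A \<in> SL n" using A by (simp add: SL_def)
  then obtain B where B: "B \<in> carrier_mat n n" "?A * B = 1\<^sub>m n" "minv ?A = B"
    using SL_inverse by blast
  have sA: "sigma l A = adj l B" using B by (simp add: sigma_def theta_eq tw_def[abs_def])
  have "sigma l A = A \<longleftrightarrow> B = adj l A" unfolding sA using A B adj_adj by metis
  also have "B = adj l A \<longleftrightarrow> ?A * adj l A = 1\<^sub>m n"
    using A B minv_eqI[of ?A n "adj l A"] by auto
  \<comment> \<open>The twist is a ring involution: applied to the whole equation, it moves from the
    first factor to the second.\<close>
  also have "?A * adj l A = 1\<^sub>m n \<longleftrightarrow> A * tstar A = 1\<^sub>m n"
  proof -
    have "map_mat tw (?A * adj l A) = A * tstar A"
      using A by (simp add: tw.mat_hom_mult[of _ n n _ n] map_tw_tw tstar_def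
          adj_hom[OF tw.comm_ring_hom_axioms])
    then show ?thesis
      using map_tw_tw[of "?A * adj l A"] tw.mat_hom_one[of n] by auto
  qed
  finally show ?thesis .
qed

lemma G_sigma_iff:
  "A \<in> G_sigma l S \<longleftrightarrow>
    A \<in> carrier_mat n n \<and> det A = 1 \<and> elements_mat A \<subseteq> S \<and> A * tstar A = 1\<^sub>m n"
  using sigma_fixed_iff[of A] unfolding G_sigma_def n_eq[symmetric] by (auto simp: SL_def)

lemma G_carrier: "A \<in> G_sigma l S \<Longrightarrow> A \<in> carrier_mat n n"
  by (simp add: G_sigma_iff)

lemma G_tstar_right: "A \<in> G_sigma l S \<Longrightarrow> A * tstar A = 1\<^sub>m n"
  by (simp add: G_sigma_iff)

lemma G_tstar_left:
  assumes "A \<in> G_sigma l S"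
  shows "tstar A * A = 1\<^sub>m n"
  by (rule mat_mult_left_right_inverse[OF _ _ G_tstar_right[OF assms]]) (simp_all add: G_carrier[OF assms])

lemma G_mono: "S \<subseteq> S' \<Longrightarrow> A \<in> G_sigma l S \<Longrightarrow> A \<in> G_sigma l S'"
  by (auto simp: G_sigma_iff)

lemma G_mult:
  assumes S: "stable_subring S" and A: "A \<in> G_sigma l S" and B: "B \<in> G_sigma l S"
  shows "A * B \<in> G_sigma l S"
proof -
  have [simp]: "A \<in> carrier_mat n n" "B \<in> carrier_mat n n" using A B by (auto intro: G_carrier)
  have "B * (tstar B * tstar A) = tstar A"
    using mult_assoc[of B "tstar B" "tstar A"] G_tstar_right[OF B] by simp
  then have "A * B * tstar (A * B) = 1\<^sub>m n"
    by (simp add: tstar_mult mult_assoc G_tstar_right[OF A])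
  then show ?thesis
    using A B stable_mat_mult[OF S, of A n B] by (simp add: G_sigma_iff det_mult[of _ n])
qed

lemma stable_sign:
  assumes "stable_subring S" "f \<in> S"
  shows "(-1)^k * f \<in> S"
proof -
  have "(-1)^k = (fls_const ((-1)^k) :: complex fls)" by (simp add: hom_distribs)
  then show ?thesis using stable_subringD(1,4)[OF assms(1)] assms(2) by metis
qed

lemma G_tstar:
  assumes S: "stable_subring S" and A: "A \<in> G_sigma l S"
  shows "tstar A \<in> G_sigma l S"
proof -
  have [simp]: "A \<in> carrier_mat n n" and d: "det A = 1" using A by (auto simp: G_sigma_iff)
  have "det A * det (tstar A) = 1" using G_tstar_right[OF A] by (simp flip: det_mult[of _ n])
  moreover have "\<forall>i<n. \<forall>j<n. A $$ (i,j) \<in> S" using A by (simp add: G_sigma_iff elements_mat_iff[of A n n])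
  then have "elements_mat (tstar A) \<subseteq> S"
    by (subst elements_mat_iff[of _ n n])
      (auto simp: tstar_def adj_index carrier_matD[of A n n]
        intro!: stable_sign[OF S] stable_subringD(2)[OF S])
  ultimately show ?thesis using d by (simp add: G_sigma_iff tstar_tstar G_tstar_left[OF A])
qed

lemma G_one:
  assumes "stable_subring S"
  shows "1\<^sub>m n \<in> G_sigma l S"
proof -
  have "0 \<in> S" "1 \<in> S"
    using stable_subringD(1)[OF assms, of 0] stable_subringD(1)[OF assms, of 1] by simp_all
  then have "elements_mat (1\<^sub>m n) \<subseteq> S" by (simp add: elements_mat_iff[of _ n n])
  moreover have "tstar (1\<^sub>m n) = 1\<^sub>m n" by (simp add: tstar_def tw.mat_hom_one adj_one)
  ultimately show ?thesis by (simp add: G_sigma_iff)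
qed

abbreviation lift :: "complex mat \<Rightarrow> complex fls mat" where
  "lift x \<equiv> map_mat fls_const x"

lemma map_tw_lift: "map_mat tw (lift x) = lift x"
  by (rule eq_matI) (simp_all add: tw_def)

lemma tstar_lift: "x \<in> carrier_mat n n \<Longrightarrow> tstar (lift x) = lift (adj l x)"
  by (simp add: tstar_def map_tw_lift adj_hom[OF fls_const.comm_ring_hom_axioms])

lemma lift_mult:
  "x \<in> carrier_mat n n \<Longrightarrow> y \<in> carrier_mat n n \<Longrightarrow> lift (x * y) = lift x * lift y"
  by (rule fls_const.mat_hom_mult)

lemma lift_G:
  assumes S: "stable_subring S" and k: "k \<in> Kgrp l"
  shows "lift k \<in> G_sigma l S"
proof -
  have kc: "k \<in> carrier_mat n n" and d: "det k = 1" using k by (simp_all add: Kgrp_iff)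
  have "elements_mat (lift k) \<subseteq> S"
    using kc stable_subringD(1)[OF S] by (subst elements_mat_iff[of _ n n]) auto
  moreover have "lift k * tstar (lift k) = 1\<^sub>m n"
    unfolding tstar_lift[OF kc] lift_mult[OF kc adj_carrier[OF kc], symmetric]
      Kgrp_inverse(2)[OF k] by (rule fls_const.mat_hom_one)
  moreover have "det (lift k) = 1" by (simp add: d)
  ultimately show ?thesis using kc by (simp add: G_sigma_iff)
qed

section \<open>Cosets and their normalized representatives\<close>

lemma act_act:
  assumes "g \<in> carrier_mat n n" "h \<in> carrier_mat n n" "c \<subseteq> carrier_mat n n"
  shows "act g (act h c) = act (g * h) c"
  unfolding act_def image_image using assms
  by (intro image_cong refl) (auto simp: mult_assoc)

lemma e0_carrier: "e0 l \<subseteq> carrier_mat n n"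
  by (auto simp: e0_def G_sigma_iff)

lemma act_e0:
  assumes h: "h \<in> G_sigma l fls_O"
  shows "act h (e0 l) = e0 l"
proof (rule subset_antisym)
  show "act h (e0 l) \<subseteq> e0 l"
    unfolding act_def e0_def by (intro image_subsetI G_mult stable_O h)
  show "e0 l \<subseteq> act h (e0 l)"
  proof
    fix a assume a: "a \<in> e0 l"
    have "tstar h * a \<in> e0 l"
      using a unfolding e0_def by (intro G_mult G_tstar stable_O h)
    moreover have "h * (tstar h * a) = a"
      using mult_assoc[of h "tstar h" a] G_carrier[OF h] G_tstar_right[OF h] subsetD[OF e0_carrier a]
      by simp
    ultimately show "a \<in> act h (e0 l)" unfolding act_def by (metis imageI)
  qed
qed

lemma act_mult_e0:
  assumes "g \<in> G_sigma l UNIV" "h \<in> G_sigma l fls_O"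
  shows "act (g * h) (e0 l) = act g (e0 l)"
  using act_act[OF _ _ e0_carrier, of g h] act_e0[OF assms(2)] assms by (simp add: G_carrier)

text \<open>The coset of g contains g. The set c stays general so that the nested coset
  \<open>act (npow l b) (e0 l)\<close> can take its place.\<close>

lemma act_e0_eqD:
  assumes "act g (e0 l) = act g' c" "g \<in> carrier_mat n n"
  obtains h where "h \<in> c" "g = g' * h"
proof -
  have "g * 1\<^sub>m n \<in> act g (e0 l)" using G_one[OF stable_O] by (auto simp: act_def e0_def)
  then have "g \<in> act g' c" using assms by simp
  then show ?thesis using that unfolding act_def by blast
qed

lemma G_O_minus_0_iff: "A \<in> G_O_minus_0 l \<longleftrightarrow> A \<in> G_sigma l fls_O_minus \<and> ev0 A = 1\<^sub>m n"
  by (simp add: G_O_minus_0_def ev0_def n_eq)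

lemma ev0_one: "ev0 (1\<^sub>m n) = 1\<^sub>m n"
  by (rule eq_matI) (auto simp: ev0_def)

lemma ev0_G_mult:
  assumes "evaluable S" "A \<in> G_sigma l S" "B \<in> G_sigma l S"
  shows "ev0 (A * B) = ev0 A * ev0 B"
  using assms by (intro ev0_mult[of S A n B]) (simp_all add: G_sigma_iff)

lemma ev0_tstar:
  assumes S: "evaluable S" and A: "A \<in> G_sigma l S"
  shows "ev0 A * ev0 (tstar A) = 1\<^sub>m n"
proof -
  have "stable_subring S" using S by (simp add: evaluable_def)
  then have "tstar A \<in> G_sigma l S" using A by (rule G_tstar)
  then have "ev0 (A * tstar A) = ev0 A * ev0 (tstar A)"
    by (rule ev0_G_mult[OF S A])
  then show ?thesis using G_tstar_right[OF A] by (simp add: ev0_one)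
qed

lemma fls_O_Int_minus:
  assumes "f \<in> fls_O" "f \<in> fls_O_minus"
  shows "f = fls_const (fls_nth f 0)"
proof (rule fls_eqI)
  fix k :: int
  consider "k < 0" | "k = 0" | "k > 0" by linarith
  then show "fls_nth f k = fls_nth (fls_const (fls_nth f 0)) k"
    by cases (use assms in \<open>simp_all add: fls_O_def fls_O_minus_def\<close>)
qed

lemma rep_act:
  assumes A: "A \<in> G_O_minus_0 l"
  shows "rep l (act A (e0 l)) = A"
  unfolding rep_def
proof (rule the_equality)
  fix A' assume A': "A' \<in> G_O_minus_0 l \<and> act A' (e0 l) = act A (e0 l)"
  have G: "A \<in> G_sigma l fls_O_minus" "A' \<in> G_sigma l fls_O_minus" "ev0 A = 1\<^sub>m n" "ev0 A' = 1\<^sub>m n"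
    using A A' by (auto simp: G_O_minus_0_iff)
  have [simp]: "A \<in> carrier_mat n n" "A' \<in> carrier_mat n n" using G by (auto intro: G_carrier)
  obtain h where h: "h \<in> e0 l" "A' = A * h"
    by (rule act_e0_eqD[of A' A "e0 l"]) (use A' in simp_all)
  have [simp]: "h \<in> carrier_mat n n" using h e0_carrier by auto
  have tA: "tstar A \<in> G_sigma l fls_O_minus" by (rule G_tstar[OF stable_O_minus G(1)])
  \<comment> \<open>The quotient of two representatives lies in both rings, hence is constant, and
    its value at infinity is the identity.\<close>
  have eq: "h = tstar A * A'"
    using mult_assoc[of "tstar A" A h] G_tstar_left[OF G(1)] h(2) by simp
  have hm: "h \<in> G_sigma l fls_O_minus" unfolding eq by (rule G_mult[OF stable_O_minus tA G(2)])
  have "ev0 (tstar A) = 1\<^sub>m n" using ev0_tstar[OF evaluable_O_minus G(1)] G(3) by simp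
  moreover have "ev0 h = ev0 (tstar A) * ev0 A'"
    unfolding eq by (rule ev0_G_mult[OF evaluable_O_minus tA G(2)])
  ultimately have ev: "ev0 h = 1\<^sub>m n" using G(4) by simp
  have "h = 1\<^sub>m n"
  proof (rule eq_matI)
    fix i j assume "i < dim_row (1\<^sub>m n :: complex fls mat)" "j < dim_col (1\<^sub>m n :: complex fls mat)"
    then have ij: "i < n" "j < n" by auto
    then have "h $$ (i,j) \<in> fls_O" "h $$ (i,j) \<in> fls_O_minus"
      using h(1) hm by (simp_all add: e0_def G_sigma_iff elements_mat_iff[of h n n])
    then have "h $$ (i,j) = fls_const (ev0 h $$ (i,j))"
      using fls_O_Int_minus[of "h $$ (i,j)"] ij by (simp add: ev0_def carrier_matD[of h n n])
    then show "h $$ (i,j) = 1\<^sub>m n $$ (i,j)" using ij ev by simp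
  qed (simp_all add: carrier_matD[of h n n])
  then show "A' = A" using h(2) by simp
qed (use A in simp)

text \<open>The value k of g at infinity belongs to K. Dividing by it on the right normalizes g, and
  the coset is unchanged since constants also lie in \<open>fls_O\<close>.\<close>

lemma Gr_minus_0_rep:
  assumes "c \<in> Gr_minus_0 l"
  obtains A where "A \<in> G_O_minus_0 l" "c = act A (e0 l)"
proof -
  obtain g where g: "g \<in> G_sigma l fls_O_minus" "c = act g (e0 l)"
    using assms unfolding Gr_minus_0_def by blast
  have gc [simp]: "g \<in> carrier_mat n n" by (rule G_carrier[OF g(1)])
  let ?k = "ev0 g"
  have adjk: "ev0 (tstar g) = adj l ?k"
  proof (rule eq_matI)
    fix i j assume "i < dim_row (adj l ?k)" "j < dim_col (adj l ?k)"
    then have ij: "i < n" "j < n" by auto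
    have "fls_nth ((-1) ^ k * f) 0 = (-1) ^ k * fls_nth f 0" for k and f :: "complex fls"
      by (cases "even k") simp_all
    then show "ev0 (tstar g) $$ (i,j) = adj l ?k $$ (i,j)"
      using ij by (simp add: ev0_def tstar_def adj_index tw_nth carrier_matD[of g n n])
  qed (simp_all add: ev0_def tstar_def)
  have k: "?k \<in> Kgrp l"
    using ev0_tstar[OF evaluable_O_minus g(1)] ev0_det[OF evaluable_O_minus gc] g(1)
    by (simp add: Kgrp_iff adjk G_sigma_iff)
  have k': "adj l ?k \<in> Kgrp l"
  proof -
    have "det ?k * det (adj l ?k) = 1"
      using Kgrp_inverse(2)[OF k] by (simp flip: det_mult[of _ n])
    then show ?thesis using Kgrp_inverse[OF k] k by (simp add: Kgrp_iff adj_adj)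
  qed
  define A where "A = g * lift (adj l ?k)"
  have A: "A \<in> G_sigma l fls_O_minus"
    unfolding A_def by (intro G_mult stable_O_minus g(1) lift_G k')
  have "ev0 A = ?k * ev0 (lift (adj l ?k))"
    unfolding A_def by (rule ev0_G_mult[OF evaluable_O_minus g(1) lift_G[OF stable_O_minus k']])
  also have "ev0 (lift (adj l ?k)) = adj l ?k"
    by (rule eq_matI) (auto simp: ev0_def)
  finally have "A \<in> G_O_minus_0 l" using A Kgrp_inverse(2)[OF k] by (simp add: G_O_minus_0_iff)
  moreover have "c = act A (e0 l)"
    unfolding A_def g(2) using G_mono[OF subset_UNIV g(1)] lift_G[OF stable_O k']
    by (rule act_mult_e0[symmetric])
  ultimately show ?thesis using that by blast
qed

end

section \<open>The cells and the map pi\<close>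

context odd_dimension
begin

text \<open>Used with \<open>c = t^-1\<close> for the representatives and with \<open>c = -t\<close>
  for a factor with entries in \<open>fls_O\<close>.\<close>

definition unip :: "complex fls \<Rightarrow> complex mat \<Rightarrow> complex fls mat" where
  "unip c y = 1\<^sub>m n + c \<cdot>\<^sub>m lift y"

lemma unip_carrier [simp]: "y \<in> carrier_mat n n \<Longrightarrow> unip c y \<in> carrier_mat n n"
  by (simp add: unip_def)

lemma unip_index:
  "y \<in> carrier_mat n n \<Longrightarrow> i < n \<Longrightarrow> j < n \<Longrightarrow>
    unip c y $$ (i,j) = (if i = j then 1 else 0) + c * fls_const (y $$ (i,j))"
  by (simp add: unip_def)

lemma unip_mult:
  assumes "x \<in> carrier_mat n n" "y \<in> carrier_mat n n"
  shows "unip c x * unip d y = 1\<^sub>m n + c \<cdot>\<^sub>m lift x + d \<cdot>\<^sub>m lift y + (c * d) \<cdot>\<^sub>m lift (x * y)"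
proof -
  let ?X = "c \<cdot>\<^sub>m lift x" and ?Y = "d \<cdot>\<^sub>m lift y"
  have [simp]: "?X \<in> carrier_mat n n" "?Y \<in> carrier_mat n n" using assms by auto
  have XY: "?X * ?Y = (c * d) \<cdot>\<^sub>m lift (x * y)"
    using assms by (intro eq_matI) (auto simp: lift_mult[OF assms] scalar_prod_def sum_distrib_left mult_ac)
  have "unip c x * unip d y = (1\<^sub>m n + ?X) * 1\<^sub>m n + (1\<^sub>m n + ?X) * ?Y"
    unfolding unip_def by (rule mult_add_distrib_mat[of _ n n _ n]) auto
  also have "(1\<^sub>m n + ?X) * ?Y = 1\<^sub>m n * ?Y + ?X * ?Y"
    by (rule add_mult_distrib_mat[of _ n n _ _ n]) auto
  finally show ?thesis
    using assms assoc_add_mat[of "1\<^sub>m n + ?X" n n ?Y "?X * ?Y"] by (simp add: XY)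
qed

lemma tstar_unip:
  assumes "y \<in> carrier_mat n n"
  shows "tstar (unip c y) = unip (tw c) (adj l y)"
proof (rule eq_matI)
  fix i j assume "i < dim_row (unip (tw c) (adj l y))" "j < dim_col (unip (tw c) (adj l y))"
  then have ij: "i < n" "j < n" using assms by (auto simp: unip_def)
  have sign: "fls_const ((-1)^k * a) = (-1)^k * fls_const a" for k and a :: complex
    by (cases "even k") simp_all
  have "tw (fls_const a) = fls_const a" for a by (simp add: tw_def)
  moreover have "(2*l - j = 2*l - i) = (i = j)" using ij n_eq by auto
  ultimately show "tstar (unip c y) $$ (i,j) = unip (tw c) (adj l y) $$ (i,j)"
    using ij assms
    by (cases "even (i+j)")
      (auto simp: tstar_def adj_index unip_index carrier_matD[of "unip c y" n n] sign
        tw.hom_add tw.hom_mult)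
qed (use assms in \<open>simp_all add: tstar_def carrier_matD[of "unip (tw c) (adj l y)" n n]\<close>)

lemma upper_triangular_unipotent_det:
  fixes A :: "'a::comm_ring_1 mat"
  assumes "A \<in> carrier_mat n n" "\<And>i j. i < n \<Longrightarrow> j < n \<Longrightarrow> j \<le> i \<Longrightarrow> A $$ (i,j) = (if i = j then 1 else 0)"
  shows "det A = 1"
proof -
  have "upper_triangular A" using assms unfolding upper_triangular_def by auto
  then have "det A = prod_list (diag_mat A)" using assms(1) by (rule det_upper_triangular)
  also have "diag_mat A = replicate n 1"
    using assms by (intro nth_equalityI) (auto simp: diag_mat_def)
  finally show ?thesis by simp
qed

lemma unip_conjugate:
  assumes k: "k \<in> Kgrp l" and x: "x \<in> carrier_mat n n"
  shows "lift k * unip c x * lift (adj l k) = unip c (k * x * adj l k)"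
proof -
  have [simp]: "k \<in> carrier_mat n n" using Kgrp_inverse[OF k] by simp
  have kk: "lift k * lift (adj l k) = 1\<^sub>m n"
    using Kgrp_inverse(2)[OF k] by (simp add: fls_const.mat_hom_one flip: lift_mult)
  let ?C = "c \<cdot>\<^sub>m lift x"
  have [simp]: "?C \<in> carrier_mat n n" using x by simp
  have "lift k * unip c x = lift k * 1\<^sub>m n + lift k * ?C"
    unfolding unip_def by (rule mult_add_distrib_mat[of _ n n _ n]) auto
  then have "lift k * unip c x * lift (adj l k)
      = lift k * lift (adj l k) + lift k * ?C * lift (adj l k)"
    by (simp add: add_mult_distrib_mat[of _ n n _ _ n])
  also have "lift k * ?C * lift (adj l k) = c \<cdot>\<^sub>m (lift k * lift x * lift (adj l k))"
    using x by (simp add: mult_smult_distrib[of _ n n _ n] mult_smult_assoc_mat[of _ n n _ n])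
  also have "lift k * lift x * lift (adj l k) = lift (k * x * adj l k)"
    using x by (simp add: lift_mult)
  finally show ?thesis by (simp add: kk unip_def)
qed

text \<open>Conjugation by K brings y to \<open>std j\<close>, which is strictly upper
  triangular.\<close>

lemma det_unip:
  assumes "y \<in> p_sq0"
  shows "det (unip c y) = 1"
proof -
  obtain j where "has_rank n j y" using p_sq0_rank_exists[OF assms] .
  then obtain k where j: "j \<le> l" and k: "k \<in> Kgrp l" and y: "y = k * std j * adj l k"
    using p_sq0_conjugate_std[OF assms] by blast
  have [simp]: "k \<in> carrier_mat n n" using Kgrp_inverse[OF k] by simp
  have kk: "lift k * lift (adj l k) = 1\<^sub>m n"
    using Kgrp_inverse(2)[OF k] by (simp add: fls_const.mat_hom_one flip: lift_mult)
  have eq: "lift k * unip c (std j) * lift (adj l k) = unip c y"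
    unfolding y by (rule unip_conjugate[OF k std_carrier])
  have "det (unip c (std j)) = 1"
  proof (rule upper_triangular_unipotent_det)
    fix a b assume "a < n" "b < n" "b \<le> a"
    then show "unip c (std j) $$ (a,b) = (if a = b then 1 else 0)"
      using j by (auto simp: unip_index std_index)
  qed simp
  moreover have "det (lift k) * det (lift (adj l k)) = 1"
    using arg_cong[OF kk, of det] det_mult[of "lift k" n "lift (adj l k)"] by simp
  ultimately show ?thesis
    by (simp add: eq[symmetric] det_mult[of _ n])
qed

text \<open>For odd c the fixed point equation reads
  \<open>(I + c y)(I - c y) = I - c^2 y^2 = I\<close>.\<close>

lemma unip_G:
  assumes S: "stable_subring S" and y: "y \<in> p_sq0" and c: "c \<in> S" "tw c = - c"
  shows "unip c y \<in> G_sigma l S"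
proof -
  have y': "y \<in> carrier_mat n n" "adj l y = y" "y * y = 0\<^sub>m n n" using y by (auto simp: p_sq0_def)
  have "elements_mat (unip c y) \<subseteq> S"
    using y'(1) stable_subringD(1)[OF S, of 1] stable_subringD(1)[OF S] c(1)
    by (subst elements_mat_iff[of _ n n])
      (auto simp: unip_index intro!: stable_subringD(3)[OF S] stable_subringD(4)[OF S])
  moreover have "unip c y * tstar (unip c y) = 1\<^sub>m n"
    using y' by (simp add: tstar_unip c(2) unip_mult) (rule eq_matI, auto)
  ultimately show ?thesis using y'(1) det_unip[OF y] by (simp add: G_sigma_iff)
qed

definition phi :: "complex mat \<Rightarrow> complex fls mat" where
  "phi x = unip fls_X_inv x"

lemma tw_X_inv: "tw fls_X_inv = - fls_X_inv"
  by (rule fls_eqI) (simp add: tw_nth)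

lemma tw_X: "tw fls_X = - fls_X"
  by (rule fls_eqI) (simp add: tw_nth)

lemma phi_nth:
  assumes "x \<in> carrier_mat n n" "i < n" "j < n"
  shows "fls_nth (phi x $$ (i,j)) k =
    (if k = 0 then if i = j then 1 else 0 else if k = -1 then x $$ (i,j) else 0)"
  using assms by (auto simp: phi_def unip_index)

lemma phi_G:
  assumes "x \<in> p_sq0"
  shows "phi x \<in> G_O_minus_0 l"
proof -
  have "phi x \<in> G_sigma l fls_O_minus"
    unfolding phi_def by (rule unip_G[OF stable_O_minus assms _ tw_X_inv]) (simp add: fls_O_minus_def)
  moreover have "ev0 (phi x) = 1\<^sub>m n"
    using p_sq0_carrier[OF assms] phi_nth[OF p_sq0_carrier[OF assms]]
    by (intro eq_matI) (auto simp: ev0_def phi_def carrier_matD[of "unip fls_X_inv x" n n])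
  ultimately show ?thesis by (simp add: G_O_minus_0_iff)
qed

text \<open>In the fixed point equation the coefficient of \<open>t^-1\<close> is the difference of
  x and its adjoint; that of \<open>t^-2\<close> is minus their product.\<close>

lemma phi_G_imp_p_sq0:
  assumes x: "x \<in> carrier_mat n n" and G: "phi x \<in> G_sigma l S"
  shows "x \<in> p_sq0"
proof -
  have eq: "1\<^sub>m n + fls_X_inv \<cdot>\<^sub>m lift x + (- fls_X_inv) \<cdot>\<^sub>m lift (adj l x)
      + (fls_X_inv * (- fls_X_inv)) \<cdot>\<^sub>m lift (x * adj l x) = 1\<^sub>m n"
    using G_tstar_right[OF G] x by (simp add: phi_def tstar_unip unip_mult tw_X_inv)
  have ent: "fls_X_inv * fls_const (x $$ (i,j)) + (- (fls_X_inv * fls_const (adj l x $$ (i,j)))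
      - fls_X_inv * (fls_X_inv * fls_const ((x * adj l x) $$ (i,j)))) = 0"
    if ij: "i < n" "j < n" for i j
  proof -
    have "(1\<^sub>m n + fls_X_inv \<cdot>\<^sub>m lift x + (- fls_X_inv) \<cdot>\<^sub>m lift (adj l x)
      + (fls_X_inv * (- fls_X_inv)) \<cdot>\<^sub>m lift (x * adj l x)) $$ (i,j) = 1\<^sub>m n $$ (i,j)"
      by (simp only: eq)
    then show ?thesis
      using ij x by (simp add: carrier_matD[of x n n] mult.assoc del: index_mult_mat(1))
  qed
  have "x $$ (i,j) = adj l x $$ (i,j)" if "i < n" "j < n" for i j
    using arg_cong[OF ent[OF that], of "\<lambda>f. fls_nth f (-1)"]
    by (simp add: fls_X_inv_times_conv_shift del: index_mult_mat(1))
  then have x': "adj l x = x" using x by (intro eq_matI) auto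
  have "(x * x) $$ (i,j) = 0" if "i < n" "j < n" for i j
    using arg_cong[OF ent[OF that], of "\<lambda>f. fls_nth f (-2)"] 
    by (simp add: x' fls_X_inv_times_conv_shift del: index_mult_mat(1))
  then have "x * x = 0\<^sub>m n n"
    using x by (intro eq_matI) (auto simp del: index_mult_mat(1))
  then show ?thesis using x x' by (simp add: p_sq0_def)
qed

end

section \<open>Monomials, diagonal matrices and the elements \<open>n^\<lambda>\<close>\<close>

definition fls_mono :: "complex \<Rightarrow> int \<Rightarrow> complex fls" where
  "fls_mono c m = fls_shift (-m) (fls_const c)"

lemma fls_mono_nth [simp]: "fls_nth (fls_mono c m) k = (if k = m then c else 0)"
  by (auto simp: fls_mono_def)

lemma mult_fls_mono_nth: "fls_nth (f * fls_mono c m) k = c * fls_nth f (k - m)"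
  by (simp add: fls_mono_def fls_shifted_times_simps)

lemma fls_mono_mult: "fls_mono c m * fls_mono d k = fls_mono (c * d) (m + k)"
  by (rule fls_eqI) (auto simp: mult_fls_mono_nth)

lemma fls_X_mult_fls_mono: "fls_X * fls_mono c m = fls_mono c (1 + m)"
  by (rule fls_eqI) (auto simp: fls_X_times_conv_shift)

lemma tw_fls_mono: "tw (fls_mono c m) = fls_mono (c * (-1) powi m) m"
  by (rule fls_eqI) (simp add: tw_nth)

lemma fls_mono_1_0: "fls_mono 1 0 = 1"
  by (simp add: fls_mono_def)

lemma prod_fls_mono: "(\<Prod>i\<in>I. fls_mono (c i) (m i)) = fls_mono (\<Prod>i\<in>I. c i) (\<Sum>i\<in>I. m i)"
  by (induction I rule: infinite_finite_induct) (simp_all add: fls_mono_1_0 fls_mono_mult)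

lemma prod_minus_one_powi: "(\<Prod>i\<in>I. (-1::complex) powi m i) = (-1) powi (\<Sum>i\<in>I. m i)"
  by (induction I rule: infinite_finite_induct) (simp_all add: power_int_add)

definition diag :: "nat \<Rightarrow> (nat \<Rightarrow> 'a::zero) \<Rightarrow> 'a mat" where
  "diag n d = mat n n (\<lambda>(i,j). if i = j then d i else 0)"

lemma diag_carrier [simp]: "diag n d \<in> carrier_mat n n"
  by (simp add: diag_def)

lemma mult_diag_index:
  fixes A :: "'a::semiring_0 mat"
  assumes "A \<in> carrier_mat n n" "i < n" "j < n"
  shows "(A * diag n d) $$ (i,j) = A $$ (i,j) * d j"
proof -
  have "(A * diag n d) $$ (i,j) = (\<Sum>k\<in>{0..<n}. A $$ (i,k) * (if k = j then d k else 0))"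
    using assms by (simp add: diag_def scalar_prod_def)
  also have "\<dots> = (\<Sum>k\<in>{0..<n}. if k = j then A $$ (i,j) * d j else 0)"
    by (intro sum.cong) auto
  finally show ?thesis using assms by simp
qed

lemma diag_mult: "diag n d * diag n e = diag n (\<lambda>i. d i * e i :: 'a::semiring_0)"
proof (rule eq_matI)
  fix i j
  assume "i < dim_row (diag n (\<lambda>i. d i * e i))" "j < dim_col (diag n (\<lambda>i. d i * e i))"
  then have ij: "i < n" "j < n" by (auto simp: diag_def)
  show "(diag n d * diag n e) $$ (i,j) = diag n (\<lambda>i. d i * e i) $$ (i,j)"
    unfolding mult_diag_index[OF diag_carrier ij] using ij by (simp add: diag_def)
qed (simp_all add: diag_def)

lemma diag_one: "(\<And>i. i < n \<Longrightarrow> d i = 1) \<Longrightarrow> diag n d = 1\<^sub>m n"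
  by (rule eq_matI) (auto simp: diag_def)

lemma det_diag: "det (diag n d) = (\<Prod>i<n. d i :: 'a::comm_ring_1)"
proof -
  have "upper_triangular (diag n d)" by (auto simp: upper_triangular_def diag_def)
  then have "det (diag n d) = prod_list (diag_mat (diag n d))"
    by (rule det_upper_triangular[OF _ diag_carrier])
  also have "\<dots> = (\<Prod>i<n. d i)" by (simp add: prod_list_diag_prod diag_def lessThan_atLeast0)
  finally show ?thesis .
qed

context odd_dimension
begin

lemma adj_diag: "adj l (diag n d) = diag n (\<lambda>i. d (2*l - i))"
proof (rule eq_matI)
  fix i j assume "i < dim_row (diag n (\<lambda>i. d (2*l - i)))" "j < dim_col (diag n (\<lambda>i. d (2*l - i)))"
  then have ij: "i < n" "j < n" by (auto simp: diag_def)
  have "(2*l - j = 2*l - i) = (i = j)" using ij n_eq by auto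
  then show "adj l (diag n d) $$ (i,j) = diag n (\<lambda>i. d (2*l - i)) $$ (i,j)"
    using ij by (auto simp: adj_index) (auto simp: diag_def)
qed (simp_all add: diag_def)

lemma tstar_diag: "tstar (diag n d) = diag n (\<lambda>i. tw (d (2*l - i)))"
proof -
  have "map_mat tw (diag n d) = diag n (\<lambda>i. tw (d i))"
    by (rule eq_matI) (auto simp: diag_def)
  then show ?thesis by (simp add: tstar_def adj_diag)
qed

abbreviation weight :: "int vec \<Rightarrow> nat \<Rightarrow> int" where
  "weight b i \<equiv> b $ i - b $ (2*l - i)"

text \<open>\<open>sigma\<close> contributes the inverse of \<open>(-t)\<close> to the power
  \<open>b $ (2*l - i)\<close>; this is the source of the sign. For i < l the exponents are the
  coordinates of the class of b.\<close>

definition npow_entry :: "int vec \<Rightarrow> nat \<Rightarrow> complex fls" where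
  "npow_entry b i = fls_mono ((-1) powi (b $ (2*l - i))) (weight b i)"

lemma npow_eq: "npow l b = diag n (npow_entry b)"
proof -
  have t: "tpow l b = diag n (\<lambda>i. fls_mono 1 (b $ i))"
    unfolding tpow_def n_eq[symmetric] diag_def fls_mono_def fls_const_1 ..
  let ?d = "\<lambda>i. fls_mono ((-1) powi (b $ i)) (b $ i)"
  let ?e = "\<lambda>i. fls_mono ((-1) powi (b $ i)) (- (b $ i))"
  have "map_mat tw (tpow l b) = diag n ?d"
    unfolding t by (rule eq_matI) (auto simp: diag_def tw_fls_mono)
  moreover have "minv (diag n ?d) = diag n ?e"
  proof (rule minv_eqI[OF diag_carrier diag_carrier])
    have "(-1::complex) powi m * (-1) powi m = 1" for m :: int
      by (simp flip: power_int_mult_distrib)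
    then show "diag n ?d * diag n ?e = 1\<^sub>m n"
      by (simp add: diag_mult fls_mono_mult fls_mono_1_0 diag_one)
  qed
  ultimately have "sigma l (tpow l b) = diag n (\<lambda>i. ?e (2*l - i))"
    by (simp add: sigma_def theta_eq adj_diag tw_def[abs_def])
  then show ?thesis
    by (simp add: npow_def t diag_mult fls_mono_mult npow_entry_def[abs_def])
qed

text \<open>Both the total exponent and the total sign of the determinant are governed by the
  coordinate sum of b, which is zero.\<close>

lemma npow_G:
  assumes "b \<in> cochars l"
  shows "npow l b \<in> G_sigma l UNIV"
proof -
  have s: "(\<Sum>i<n. b $ i) = 0" using assms unfolding cochars_def n_eq[symmetric] by simp
  have s': "(\<Sum>i<n. b $ (2*l - i)) = 0" using sum_reflect[of "\<lambda>i. b $ i"] s by simp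
  have "det (npow l b) = 1"
    by (simp add: npow_eq det_diag npow_entry_def prod_fls_mono prod_minus_one_powi sum_subtractf s s'
        fls_mono_1_0)
  moreover have "npow l b * tstar (npow l b) = 1\<^sub>m n"
    unfolding npow_eq tstar_diag diag_mult
  proof (rule diag_one)
    fix i assume i: "i < n"
    have "(-1::complex) powi (b $ (2*l - i)) * ((-1) powi (b $ i) *
        (-1) powi (b $ (2*l - i) - b $ i)) = 1"
      by (cases "even (b $ (2*l - i))"; cases "even (b $ i)") (simp_all add: power_int_minus_left)
    then show "npow_entry b i * tw (npow_entry b (2*l - i)) = 1"
      using i by (simp add: npow_entry_def tw_fls_mono fls_mono_mult reflect_reflect fls_mono_1_0)
  qed
  moreover have "npow l b \<in> carrier_mat n n" by (simp add: npow_eq)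
  ultimately show ?thesis by (simp add: G_sigma_iff)
qed

text \<open>The weight changes sign under reflection of the index, so the j leading ones force j
  trailing entries -1 and zeros in between.\<close>

lemma small_weight:
  assumes c: "cls l b = vec l (\<lambda>i. if i < j then 1 else 0)" and "j \<le> l" "i < n"
  shows "weight b i = (if i < j then 1 else if 2*l < i + j then -1 else 0)"
proof -
  have w: "weight b k = (if k < j then 1 else 0)" if "k < l" for k
  proof -
    have "cls l b $ k = weight b k" using that by (simp add: cls_def)
    then show ?thesis using that by (simp add: c)
  qed
  consider "i < l" | "i = l" | "l < i" by linarith
  then show ?thesis
  proof cases
    case 3
    then have "weight b (2*l - i) = (if 2*l - i < j then 1 else 0)"
      using assms n_eq by (intro w) simp
    then show ?thesis using 3 assms reflect_reflect[of i] by (auto split: if_splits)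
  qed (use w assms in auto)
qed

lemma cell_imp_phi:
  assumes A: "A \<in> G_O_minus_0 l" and cell: "act A (e0 l) \<in> Gr_cell l b"
    and b: "cls l b = vec l (\<lambda>i. if i < j then 1 else 0)" and j: "j \<le> l"
  obtains x where "x \<in> p_sq0" "has_rank n j x" "A = phi x"
proof -
  have AG: "A \<in> G_sigma l fls_O_minus" "ev0 A = 1\<^sub>m n" using A by (auto simp: G_O_minus_0_iff)
  have [simp]: "A \<in> carrier_mat n n" using AG by (simp add: G_carrier)
  obtain g where g: "g \<in> G_sigma l fls_O" "act A (e0 l) = act g (act (npow l b) (e0 l))"
    using cell unfolding Gr_cell_def by blast
  obtain h' where "h' \<in> act (npow l b) (e0 l)" and Agh': "A = g * h'"
    by (rule act_e0_eqD[OF g(2)]) simp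
  then obtain h where h: "h \<in> G_sigma l fls_O" and "h' = npow l b * h"
    by (auto simp: act_def e0_def)
  with Agh' have Agh: "A = g * (npow l b * h)" by simp
  have [simp]: "g \<in> carrier_mat n n" "h \<in> carrier_mat n n" using g h by (auto intro: G_carrier)
  have [simp]: "npow l b \<in> carrier_mat n n" by (simp add: npow_eq)
  \<comment> \<open>All weights are at least -1, so one factor t clears every pole of
    \<open>n^\<lambda>\<close>.\<close>
  define T where "T = fls_X \<cdot>\<^sub>m npow l b"
  define B where "B = fls_X \<cdot>\<^sub>m A"
  have Tc [simp]: "T \<in> carrier_mat n n" and Bc [simp]: "B \<in> carrier_mat n n"
    by (simp_all add: T_def B_def)
  have BgTh: "B = g * T * h"
    by (simp add: B_def T_def Agh mult_smult_distrib[of _ n n _ n] mult_smult_assoc_mat[of _ n n _ n]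
        mult_assoc)
  have T_entry: "T $$ (p,q) =
      (if p = q then fls_mono ((-1) powi (b $ (2*l - p))) (1 + weight b p) else 0)"
    if "p < n" "q < n" for p q
    using that by (simp add: T_def npow_eq diag_def npow_entry_def fls_X_mult_fls_mono)
  have T_O: "elements_mat T \<subseteq> fls_O"
    using small_weight[OF b j]
    by (auto simp: elements_mat_iff[OF Tc] T_entry fls_O_def)
  have gO: "elements_mat g \<subseteq> fls_O" and hO: "elements_mat h \<subseteq> fls_O"
    using g h by (auto simp: G_sigma_iff)
  have gTO: "elements_mat (g * T) \<subseteq> fls_O"
    by (rule stable_mat_mult[where n = n, OF stable_O _ _ gO T_O]) auto
  have BO: "elements_mat B \<subseteq> fls_O"
    unfolding BgTh by (rule stable_mat_mult[where n = n, OF stable_O _ _ gTO hO]) auto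
  have B_nth: "fls_nth (B $$ (p,q)) k = fls_nth (A $$ (p,q)) (k - 1)" if "p < n" "q < n" for p q k
    using that carrier_matD[of A n n] by (simp add: B_def fls_X_times_conv_shift)
  \<comment> \<open>For B the coefficient of \<open>t^0\<close> is the value at t = 0; in terms of A
    it is the coefficient of \<open>t^-1\<close>.\<close>
  define x where "x = ev0 B"
  have xc: "x \<in> carrier_mat n n" by (simp add: x_def)
  have "x = ev0 g * ev0 T * ev0 h"
    unfolding x_def BgTh
    using ev0_mult[where n = n, OF evaluable_O _ _ gTO hO] ev0_mult[where n = n, OF evaluable_O _ _ gO T_O] by simp
  moreover have "has_rank n j (ev0 T)"
  proof (rule has_rank_partial_monomial)
    show "ev0 T = mat n n (\<lambda>(p,q). \<Sum>i<j. if p = 2*l - i \<and> q = 2*l - i then (-1) powi (b $ i) else 0)"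
    proof (rule eq_matI)
      fix p q
      assume "p < dim_row (mat n n (\<lambda>(p,q). \<Sum>i<j. if p = 2*l - i \<and> q = 2*l - i then (-1) powi (b $ i) else 0 :: complex))"
        "q < dim_col (mat n n (\<lambda>(p,q). \<Sum>i<j. if p = 2*l - i \<and> q = 2*l - i then (-1) powi (b $ i) else 0 :: complex))"
      then have pq: "p < n" "q < n" by auto
      have "(\<Sum>i<j. if p = 2*l - i \<and> q = 2*l - i then (-1) powi (b $ i) else 0 :: complex)
          = (\<Sum>i<j. if i = 2*l - p then if p = q then (-1) powi (b $ (2*l - p)) else 0 else 0)"
        using pq j n_eq by (intro sum.cong) auto
      also have "\<dots> = (if 2*l - p < j \<and> p = q then (-1) powi (b $ (2*l - p)) else 0)" by auto
      \<comment> \<open>Only the last j diagonal entries of T, those of weight -1, survive at t =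
        0.\<close>
      also have "(2*l - p < j) = (1 + weight b p = 0)"
        using pq j n_eq unfolding small_weight[OF b j pq(1)] by (auto split: if_splits)
      also have "(if 1 + weight b p = 0 \<and> p = q then (-1) powi (b $ (2*l - p)) else 0)
          = ev0 T $$ (p,q)"
        using pq by (auto simp: ev0_def carrier_matD[OF Tc] T_entry)
      finally show "ev0 T $$ (p,q) = mat n n (\<lambda>(p,q). \<Sum>i<j.
          if p = 2*l - i \<and> q = 2*l - i then (-1) powi (b $ i) else 0) $$ (p,q)"
        using pq by simp
    qed (simp_all add: ev0_def carrier_matD[OF Tc])
    show "inj_on (\<lambda>i. 2*l - i) {..<j}" "inj_on (\<lambda>i. 2*l - i) {..<j}"
      using j by (auto simp: inj_on_def)
  qed simp
  moreover have "ev0 (tstar g) * ev0 g = 1\<^sub>m n"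
    using ev0_tstar[OF evaluable_O G_tstar[OF stable_O g(1)]] by (simp add: tstar_tstar)
  moreover have "ev0 h * ev0 (tstar h) = 1\<^sub>m n" by (rule ev0_tstar[OF evaluable_O h])
  ultimately have rk: "has_rank n j x"
    using has_rank_mult[of n j "ev0 T" "ev0 g" "ev0 (tstar g)" "ev0 h" "ev0 (tstar h)"] by simp
  have Aphi: "A = phi x"
  proof (rule eq_matI)
    fix p q assume "p < dim_row (phi x)" "q < dim_col (phi x)"
    then have pq: "p < n" "q < n" using xc by (auto simp: phi_def unip_def)
    show "A $$ (p,q) = phi x $$ (p,q)"
    proof (rule fls_eqI)
      fix k :: int
      consider "k > 0" | "k = 0" | "k = -1" | "k < -1" by linarith
      then show "fls_nth (A $$ (p,q)) k = fls_nth (phi x $$ (p,q)) k"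
      proof cases
        case 1
        then show ?thesis using AG(1) pq
          by (auto simp: phi_nth[OF xc pq] G_sigma_iff elements_mat_iff[of A n n] fls_O_minus_def)
      next
        case 2
        have "fls_nth (A $$ (p,q)) 0 = ev0 A $$ (p,q)" using pq carrier_matD[of A n n] by (simp add: ev0_def)
        then show ?thesis using 2 AG(2) pq by (simp add: phi_nth[OF xc pq])
      next
        case 3
        have "x $$ (p,q) = fls_nth (B $$ (p,q)) 0"
          using pq carrier_matD[OF Bc] by (simp add: x_def ev0_def)
        then show ?thesis using 3 by (simp add: phi_nth[OF xc pq] B_nth[OF pq])
      next
        case 4
        then have "fls_nth (B $$ (p,q)) (k + 1) = 0"
          using BO pq by (auto simp: elements_mat_iff[OF Bc] fls_O_def)
        then show ?thesis using 4 by (simp add: phi_nth[OF xc pq] B_nth[OF pq])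
      qed
    qed
  qed (use xc in \<open>simp_all add: phi_def unip_def carrier_matD[of A n n]\<close>)
  then have "x \<in> p_sq0" using phi_G_imp_p_sq0[OF xc, of fls_O_minus] AG(1) by simp
  then show ?thesis using that rk Aphi by blast
qed


section \<open>Elements of the form \<open>I + x t^-1\<close> lie in the cells\<close>

lemma transpose_p_sq0:
  assumes "y \<in> p_sq0"
  shows "transpose_mat y \<in> p_sq0"
proof -
  have y: "y \<in> carrier_mat n n" "adj l y = y" "y * y = 0\<^sub>m n n" using assms by (auto simp: p_sq0_def)
  have "adj l (transpose_mat y) = transpose_mat (adj l y)"
    using y(1) by (simp add: adj_def transpose_mult[of _ n n _ n] Jmat_transpose mult_assoc)
  moreover have "transpose_mat y * transpose_mat y = transpose_mat (y * y)"
    using y(1) by (simp add: transpose_mult[of _ n n _ n])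
  ultimately show ?thesis using y by (simp add: p_sq0_def)
qed

lemma std_transpose_mult_index:
  assumes "j \<le> l" "p < n" "q < n"
  shows "(std j * transpose_mat (std j)) $$ (p,q) = (if p = q \<and> p < j then 1 else 0)"
proof -
  have "(std j * transpose_mat (std j)) $$ (p,q) = (\<Sum>r\<in>{0..<n}. std j $$ (p,r) * std j $$ (q,r))"
    using assms by (simp add: scalar_prod_def carrier_matD[OF std_carrier])
  also have "\<dots> = (\<Sum>r\<in>{0..<n}. if r = 2*l - p then if p = q \<and> p < j then 1 else 0 else 0)"
  proof (intro sum.cong refl)
    fix r assume "r \<in> {0..<n}"
    then have r: "r < n" by simp
    show "std j $$ (p,r) * std j $$ (q,r) =
        (if r = 2*l - p then if p = q \<and> p < j then 1 else 0 else 0)"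
      using assms r by (auto simp: std_index simp flip: power_mult_distrib)
  qed
  finally show ?thesis by simp
qed

text \<open>On each plane spanned by \<open>e\<^sub>i\<close> and \<open>e\<^sub>2\<^sub>l\<^sub>-\<^sub>i\<close> with \<open>i < j\<close>, multiplication by
  \<open>I - t x\<^sup>T\<close> turns \<open>(1, s/t; 0, 1)\<close> into \<open>(0, s/t; -st, 1)\<close> (where \<open>s = \<plusminus>1\<close>), whose columns
  are divisible by \<open>t\<close> and \<open>t\<^sup>-\<^sup>1\<close>.\<close>

lemma phi_std_factor:
  assumes b: "b \<in> cochars l" "cls l b = vec l (\<lambda>i. if i < j then 1 else 0)" and j: "j \<le> l"
  obtains g h where "g \<in> G_sigma l fls_O" "h \<in> G_sigma l fls_O" "phi (std j) = g * npow l b * h"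
proof -
  let ?x = "std j" and ?y = "transpose_mat (std j)"
  have y: "?y \<in> p_sq0" "?y \<in> carrier_mat n n" using transpose_p_sq0[OF std_p_sq0[OF j]] by simp_all
  define H where "H = unip (- fls_X) ?y"
  have H: "H \<in> G_sigma l fls_O"
    unfolding H_def
    by (rule unip_G[OF stable_O y(1)]) (simp_all add: fls_O_def tw_X tw.hom_uminus)
  have "phi ?x \<in> G_sigma l fls_O_minus" using phi_G[OF std_p_sq0[OF j]] by (simp add: G_O_minus_0_iff)
  then have P: "phi ?x \<in> G_sigma l UNIV" by (rule G_mono[OF subset_UNIV])
  have N: "npow l b \<in> G_sigma l UNIV" by (rule npow_G[OF b(1)])
  have HU: "H \<in> G_sigma l UNIV" by (rule G_mono[OF subset_UNIV H])
  \<comment> \<open>\<open>tstar (npow l b)\<close> is the inverse of \<open>n^\<lambda>\<close>, so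
    the factorization holds by construction; what needs proof is that g has no poles.\<close>
  define g where "g = phi ?x * H * tstar (npow l b)"
  have gU: "g \<in> G_sigma l UNIV"
    unfolding g_def by (intro G_mult G_tstar stable_UNIV P HU N)
  note [simp] = G_carrier[OF P] G_carrier[OF N] G_carrier[OF H]
  define s where "s q = (-1) powi (b $ q) * (-1 :: complex) powi weight b (2*l - q)" for q
  have tN: "tstar (npow l b) = diag n (\<lambda>q. fls_mono (s q) (- weight b q))"
    unfolding npow_eq tstar_diag npow_entry_def tw_fls_mono
    by (rule eq_matI) (auto simp: diag_def s_def reflect_reflect)
  have M_nth: "fls_nth ((phi ?x * H) $$ (p,q)) k =
      (if k = 0 then if p = q \<and> \<not> p < j then 1 else 0
       else if k = -1 then ?x $$ (p,q) else if k = 1 then - ?x $$ (q,p) else 0)"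
    if pq: "p < n" "q < n" for p q k
  proof -
    have inv: "fls_X_inv * (- fls_X) = (-1 :: complex fls)"
      by (rule fls_eqI) (simp add: fls_X_inv_times_conv_shift)
    have "(phi ?x * H) $$ (p,q) = (if p = q then 1 else 0) + fls_X_inv * fls_const (?x $$ (p,q))
        + (- fls_X) * fls_const (?x $$ (q,p)) + (-1) * fls_const ((?x * ?y) $$ (p,q))"
      unfolding phi_def H_def unip_mult[OF std_carrier y(2)] inv
      using pq carrier_matD[OF std_carrier] by (simp del: index_mult_mat(1))
    then show ?thesis
      unfolding std_transpose_mult_index[OF j pq]
      by (auto simp: fls_X_times_conv_shift fls_X_inv_times_conv_shift)
  qed
  have "elements_mat g \<subseteq> fls_O"
  proof (subst elements_mat_iff[of _ n n])
    show "\<forall>p<n. \<forall>q<n. g $$ (p,q) \<in> fls_O"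
    proof (intro allI impI)
      fix p q assume pq: "p < n" "q < n"
      have "fls_nth (g $$ (p,q)) k = 0" if "k < 0" for k
      proof -
        have "fls_nth (g $$ (p,q)) k = s q * fls_nth ((phi ?x * H) $$ (p,q)) (k + weight b q)"
          unfolding g_def tN
          by (subst mult_diag_index[OF _ pq]) (simp_all add: mult_fls_mono_nth algebra_simps del: index_mult_mat(1))
        \<comment> \<open>Columns q < j contain only multiples of t and are divided by t; the last j
          columns have at most a simple pole and are multiplied by t; the middle ones have no pole
          and weight 0.\<close>
        also have "fls_nth ((phi ?x * H) $$ (p,q)) (k + weight b q) = 0"
          unfolding M_nth[OF pq] small_weight[OF b(2) j pq(2)]
          using that pq j by (auto simp: std_index)
        finally show ?thesis by simp
      qed
      then show "g $$ (p,q) \<in> fls_O" by (simp add: fls_O_def)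
    qed
  qed (simp add: g_def)
  then have gO: "g \<in> G_sigma l fls_O" using gU by (simp add: G_sigma_iff)
  have "g * npow l b = phi ?x * H"
    using mult_assoc[of "phi ?x * H" "tstar (npow l b)" "npow l b"] G_tstar_left[OF N]
    by (simp add: g_def)
  then have "g * npow l b * tstar H = phi ?x"
    using mult_assoc[of "phi ?x" H "tstar H"] G_tstar_right[OF H] by simp
  then show ?thesis using that[OF gO G_tstar[OF stable_O H]] by simp
qed

text \<open>Conjugation by K multiplies the factorization for \<open>std j\<close> by constants on
  both sides: the left one joins g, the right one is absorbed by the base point.\<close>

lemma phi_in_cell:
  assumes x: "x \<in> p_sq0" "has_rank n j x"
    and b: "b \<in> cochars l" "cls l b = vec l (\<lambda>i. if i < j then 1 else 0)"
  shows "act (phi x) (e0 l) \<in> Gr_cell l b"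
proof -
  obtain k where j: "j \<le> l" and k: "k \<in> Kgrp l" and xk: "x = k * std j * adj l k"
    using p_sq0_conjugate_std[OF x] .
  obtain g h where g: "g \<in> G_sigma l fls_O" and h: "h \<in> G_sigma l fls_O"
    and gh: "phi (std j) = g * npow l b * h"
    using phi_std_factor[OF b j] .
  let ?K = "lift k" and ?K' = "lift (adj l k)"
  have K: "?K \<in> G_sigma l fls_O" by (rule lift_G[OF stable_O k])
  have K': "?K' \<in> G_sigma l fls_O"
    using G_tstar[OF stable_O K] tstar_lift Kgrp_inverse(1)[OF k] by simp
  have N: "npow l b \<in> G_sigma l UNIV" by (rule npow_G[OF b(1)])
  note [simp] = G_carrier[OF g] G_carrier[OF h] Kgrp_inverse(1)[OF k] G_carrier[OF N]
  have Kg: "?K * g \<in> G_sigma l fls_O" and hK: "h * ?K' \<in> G_sigma l fls_O"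
    by (intro G_mult stable_O K K' g h)+
  have "phi x = ?K * phi (std j) * ?K'"
    unfolding phi_def xk by (rule unip_conjugate[OF k std_carrier, symmetric])
  also have "\<dots> = ?K * g * npow l b * (h * ?K')" by (simp add: gh mult_assoc)
  finally have "act (phi x) (e0 l) = act (?K * g * npow l b * (h * ?K')) (e0 l)" by simp
  also have "\<dots> = act (?K * g * npow l b) (e0 l)"
    by (intro act_mult_e0 hK G_mult stable_UNIV N G_mono[OF subset_UNIV K] G_mono[OF subset_UNIV g])
  also have "\<dots> = act (?K * g) (act (npow l b) (e0 l))"
    by (rule act_act[symmetric]) (simp_all add: e0_carrier)
  finally show ?thesis using Kg unfolding Gr_cell_def by blast
qed

text \<open>The right-hand side depends on j alone, so all cocharacters of one class give the same
  cell in the open set.\<close>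

lemma M_cell_eq:
  assumes "b \<in> cochars l" "cls l b = vec l (\<lambda>i. if i < j then 1 else 0)" "j \<le> l"
  shows "M_cell l b = (\<lambda>x. act (phi x) (e0 l)) ` nilp_type l j"
proof (intro subset_antisym subsetI)
  fix c assume "c \<in> M_cell l b"
  then have c: "c \<in> Gr_cell l b" "c \<in> Gr_minus_0 l" by (auto simp: M_cell_def)
  obtain A where A: "A \<in> G_O_minus_0 l" "c = act A (e0 l)" using Gr_minus_0_rep[OF c(2)] .
  obtain x where "x \<in> p_sq0" "has_rank n j x" "A = phi x"
    using cell_imp_phi[OF A(1) _ assms(2,3)] c(1) A(2) by blast
  then show "c \<in> (\<lambda>x. act (phi x) (e0 l)) ` nilp_type l j"
    using A(2) nilp_type_eq[OF assms(3)] by blast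
next
  fix c assume "c \<in> (\<lambda>x. act (phi x) (e0 l)) ` nilp_type l j"
  then obtain x where x: "x \<in> p_sq0" "has_rank n j x" "c = act (phi x) (e0 l)"
    using nilp_type_eq[OF assms(3)] by auto
  have "c \<in> Gr_minus_0 l"
    using phi_G[OF x(1)] x(3) unfolding Gr_minus_0_def G_O_minus_0_iff by blast
  then show "c \<in> M_cell l b"
    using phi_in_cell[OF x(1,2) assms(1,2)] x(3) by (simp add: M_cell_def)
qed

text \<open>The inverse sends x to the coset of \<open>I + x t^-1\<close>. Since both maps are
  polynomial, the argument covers every set Y of such matrices, hence the whole of
  \<open>Np2 l\<close> and each single orbit.\<close>

lemma pi_iso_image:
  assumes Y: "Y \<subseteq> p_sq0" and X: "X = (\<lambda>x. act (phi x) (e0 l)) ` Y"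
  shows "pi_iso l X Y"
proof -
  let ?F = "\<lambda>x. act (phi x) (e0 l)"
  have rep: "rep l (?F x) = phi x" if "x \<in> Y" for x
    using rep_act[OF phi_G] that Y by blast
  have Yc: "x \<in> carrier_mat n n" if "x \<in> Y" for x using p_sq0_carrier that Y by blast
  have pi: "pi_map l (?F x) = x" if "x \<in> Y" for x
    unfolding pi_map_def rep[OF that]
  proof (rule eq_matI)
    fix i j assume "i < dim_row x" "j < dim_col x"
    then show "map_mat (\<lambda>f. fls_nth f (-1)) (phi x) $$ (i,j) = x $$ (i,j)"
      using Yc[OF that] phi_nth[OF Yc[OF that], of i j "-1"]
      by (simp add: phi_def carrier_matD[of "unip fls_X_inv x" n n])
  qed (use Yc[OF that] in \<open>simp_all add: phi_def carrier_matD[of "unip fls_X_inv x" n n]\<close>)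
  have regI: "f \<in> regular_on C Z" if "p \<in> polys C" "\<And>z. z \<in> Z \<Longrightarrow> f z = p z"
    for f p :: "'c \<Rightarrow> complex" and C Z
  proof -
    have "\<exists>p\<in>polys C. \<exists>q\<in>polys C. q x \<noteq> 0 \<and> (\<forall>y\<in>Z. q y \<noteq> 0 \<longrightarrow> f y = p y / q y)" for x
      using that by (intro bexI[of _ p] bexI[of _ "\<lambda>_. 1"]) (simp_all add: polys.const)
    then show ?thesis unfolding regular_on_def by blast
  qed
  have "regular_map (coords_Gr l) (coords_mat l) (pi_map l) X Y"
    unfolding regular_map_def
  proof (intro conjI ballI)
    show "pi_map l ` X \<subseteq> Y" using pi X by auto
    fix u assume "u \<in> coords_mat l"
    then obtain i j where ij: "i < n" "j < n" "u = (\<lambda>x. x $$ (i,j))"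
      unfolding coords_mat_def n_eq[symmetric] by blast
    show "(\<lambda>c. u (pi_map l c)) \<in> regular_on (coords_Gr l) X"
    proof (rule regI)
      show "(\<lambda>c. fls_nth (rep l c $$ (i,j)) (-1)) \<in> polys (coords_Gr l)"
        unfolding coords_Gr_def n_eq[symmetric] using ij by (intro polys.coord) blast
      fix c assume "c \<in> X"
      then obtain x where x: "x \<in> Y" "c = ?F x" using X by blast
      then show "u (pi_map l c) = fls_nth (rep l c $$ (i,j)) (-1)"
        using ij pi rep phi_nth[OF Yc] by simp
    qed
  qed
  moreover have "regular_map (coords_mat l) (coords_Gr l) ?F Y X"
    unfolding regular_map_def
  proof (intro conjI ballI)
    show "?F ` Y \<subseteq> X" using X by blast
    fix u assume "u \<in> coords_Gr l"
    then obtain i j k where ij: "i < n" "j < n" "u = (\<lambda>c. fls_nth (rep l c $$ (i,j)) k)"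
      unfolding coords_Gr_def n_eq[symmetric] by blast
    have coord: "(\<lambda>x. x $$ (i,j)) \<in> polys (coords_mat l)"
      unfolding coords_mat_def n_eq[symmetric] using ij by (intro polys.coord) blast
    \<comment> \<open>Every coordinate of \<open>I + x t^-1\<close> is a constant or a matrix entry
      of x, hence a polynomial with denominator 1.\<close>
    let ?p = "\<lambda>x. if k = 0 then if i = j then 1 else 0 else if k = -1 then x $$ (i,j) else 0 :: complex"
    show "(\<lambda>x. u (?F x)) \<in> regular_on (coords_mat l) Y"
    proof (rule regI)
      show "?p \<in> polys (coords_mat l)"
        using coord polys.const[of 0 "coords_mat l"] polys.const[of 1 "coords_mat l"]
        by (cases "k = 0"; cases "k = -1"; cases "i = j") simp_all
      show "u (?F x) = ?p x" if "x \<in> Y" for x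
        using that ij rep phi_nth[OF Yc] by simp
    qed
  qed
  ultimately show ?thesis
    unfolding pi_iso_def variety_iso_def using pi X by (intro conjI exI[of _ ?F]) auto
qed

end

section \<open>Small dominant weights\<close>

lemma dominates_two_gamma0_iff:
  assumes a: "dominant l a" and l: "l \<ge> 1"
  shows "dominates l a (2 \<cdot>\<^sub>v gamma0 l) \<longleftrightarrow> a $ 0 \<ge> 2"
proof -
  have nonneg: "a $ i \<ge> 0" if "i < l" for i using a that by (simp add: dominant_def)
  have g: "(2 \<cdot>\<^sub>v gamma0 l) $ i = (if i = 0 then 2 else 0)" if "i < l" for i
    using that by (simp add: gamma0_def)
  \<comment> \<open>One formula covers the last simple root too: its subtracted term would sit at i
    = l, outside the range of i.\<close>
  have root: "simple_root l k $ i = (if i = k then 1 else 0) - (if i = Suc k then 1 else 0)"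
    if "i < l" "k < l" for i k
    using that by (auto simp: simple_root_def)
  have sum: "(\<Sum>k<l. int (m k) * simple_root l k $ i)
      = int (m i) - (if i = 0 then 0 else int (m (i - 1)))" if i: "i < l" for m i
  proof -
    have "(\<Sum>k<l. int (m k) * simple_root l k $ i)
        = (\<Sum>k<l. (if k = i then int (m i) else 0)
            - (if k = i - 1 then if i = 0 then 0 else int (m (i - 1)) else 0))"
      using i by (intro sum.cong refl) (auto simp: root)
    also have "\<dots> = int (m i) - (if i = 0 then 0 else int (m (i - 1)))"
      using i by (simp add: sum_subtractf)
    finally show ?thesis .
  qed
  show ?thesis
  proof
    assume "dominates l a (2 \<cdot>\<^sub>v gamma0 l)"
    then obtain m where "\<forall>i<l. a $ i - (2 \<cdot>\<^sub>v gamma0 l) $ i = (\<Sum>k<l. int (m k) * simple_root l k $ i)"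
      unfolding dominates_def by blast
    then have "a $ 0 - 2 = int (m 0)" using l g[of 0] sum[of 0 m] by auto
    then show "a $ 0 \<ge> 2" by simp
  next
    assume a0: "a $ 0 \<ge> 2"
    \<comment> \<open>Abel summation: the coefficient of the k-th simple root in a vector is the sum
      of its coordinates up to k. The 2 comes from subtracting twice \<open>gamma0\<close>.\<close>
    define m where "m k = nat ((\<Sum>i\<le>k. a $ i) - 2)" for k
    have m: "int (m k) = (\<Sum>i\<le>k. a $ i) - 2" if "k < l" for k
    proof -
      have "(\<Sum>i\<le>k. a $ i) = a $ 0 + (\<Sum>i\<in>{1..k}. a $ i)"
        by (simp add: atMost_atLeast0 sum.atLeast_Suc_atMost)
      moreover have "(\<Sum>i\<in>{1..k}. a $ i) \<ge> 0" using nonneg that by (intro sum_nonneg) auto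
      ultimately show ?thesis using a0 by (simp add: m_def)
    qed
    have "a $ i - (2 \<cdot>\<^sub>v gamma0 l) $ i = (\<Sum>k<l. int (m k) * simple_root l k $ i)" if i: "i < l" for i
    proof (cases i)
      case 0
      then show ?thesis unfolding sum[OF i] g[OF i] using i by (simp add: m)
    next
      case (Suc k)
      then show ?thesis unfolding sum[OF i] g[OF i] using i by (simp add: m)
    qed
    then show "dominates l a (2 \<cdot>\<^sub>v gamma0 l)" unfolding dominates_def by blast
  qed
qed

lemma small_iff:
  assumes l: "l \<ge> 1"
  shows "small l a \<longleftrightarrow> (\<exists>j\<le>l. a = vec l (\<lambda>i. if i < j then 1 else 0))"
proof
  assume s: "small l a"
  then have d: "dominant l a" and "a $ 0 < 2"
    using dominates_two_gamma0_iff[OF _ l] by (auto simp: small_def)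
  have dim: "dim_vec a = l" and nonneg: "\<And>i. i < l \<Longrightarrow> a $ i \<ge> 0"
    and step: "\<And>i. i + 1 < l \<Longrightarrow> a $ (i + 1) \<le> a $ i"
    using d by (auto simp: dominant_def)
  have anti: "a $ k \<le> a $ i" if "i \<le> k" "k < l" for i k
    using that
  proof (induction k rule: dec_induct)
    case (step k)
    then show ?case using \<open>\<And>i. i + 1 < l \<Longrightarrow> a $ (i + 1) \<le> a $ i\<close>[of k] by simp
  qed simp
  have le1: "a $ i \<le> 1" if "i < l" for i using anti[of 0 i] that \<open>a $ 0 < 2\<close> by simp
  \<comment> \<open>The first position at which the entry differs from 1; the alternative
    \<open>k = l\<close> makes it exist for the all-ones weight.\<close>
  define j where "j = (LEAST k. k = l \<or> a $ k \<noteq> 1)"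
  have at_j: "j = l \<or> a $ j \<noteq> 1"
    unfolding j_def by (rule LeastI[of _ l]) simp
  have jl: "j \<le> l" unfolding j_def by (rule Least_le) simp
  have below: "i < j \<longleftrightarrow> a $ i = 1" if i: "i < l" for i
  proof
    assume "i < j"
    then show "a $ i = 1" using not_less_Least[of i "\<lambda>k. k = l \<or> a $ k \<noteq> 1"] by (simp add: j_def)
  next
    assume "a $ i = 1"
    show "i < j"
    proof (rule ccontr)
      assume "\<not> i < j"
      then have "j < l" "a $ i \<le> a $ j" using i anti[of j i] by auto
      then show False using \<open>a $ i = 1\<close> at_j le1[of j] by simp
    qed
  qed
  have "a = vec l (\<lambda>i. if i < j then 1 else 0)"
  proof (rule eq_vecI)
    fix i assume "i < dim_vec (vec l (\<lambda>i. if i < j then 1 else 0 :: int))"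
    then have i: "i < l" by simp
    show "a $ i = vec l (\<lambda>i. if i < j then 1 else 0) $ i"
      using i below[OF i] le1[OF i] nonneg[OF i] by auto
  qed (simp add: dim)
  with jl show "\<exists>j\<le>l. a = vec l (\<lambda>i. if i < j then 1 else 0)" by blast
next
  assume "\<exists>j\<le>l. a = vec l (\<lambda>i. if i < j then 1 else 0)"
  then obtain j where a: "a = vec l (\<lambda>i. if i < j then 1 else 0)" by blast
  then have "dominant l a" by (auto simp: dominant_def)
  moreover have "a $ 0 < 2" using l a by auto
  ultimately show "small l a" using dominates_two_gamma0_iff[OF _ l] by (auto simp: small_def)
qed

lemma exists_small_cochar:
  assumes "j \<le> l"
  shows "\<exists>b\<in>cochars l. cls l b = vec l (\<lambda>i. if i < j then 1 else 0)"
proof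
  \<comment> \<open>The middle coordinate is its own reflection, so \<open>cls\<close> does not see
    it; there -j restores sum zero.\<close>
  let ?b = "vec (2*l+1) (\<lambda>i. if i < j then 1 else if i = l then - int j else 0)"
  have "(\<Sum>i<2*l+1. ?b $ i) = (\<Sum>i<2*l+1. (if i < j then 1 else 0) + (if i = l then - int j else 0))"
    using assms by (intro sum.cong) auto
  also have "\<dots> = (\<Sum>i<2*l+1. if i < j then 1 else 0) - int j"
    unfolding sum.distrib by (subst sum.delta) auto
  also have "(\<Sum>i<2*l+1. if i < j then 1 else 0) = (\<Sum>i<j. 1 :: int)"
    using assms by (intro sum.mono_neutral_cong_right) auto
  finally show "?b \<in> cochars l" by (simp add: cochars_def)
  show "cls l ?b = vec l (\<lambda>i. if i < j then 1 else 0)"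
    using assms by (intro eq_vecI) (auto simp: cls_def)
qed

theorem theorem4p5:
  fixes l :: nat
  assumes "l \<ge> 1"
  shows "pi_iso l (M_small l) (Np2 l) \<and>
    (\<forall>j\<le>l.
       (\<exists>x\<in>Np l. nilp_type l j = K_orbit l x) \<and>
       (\<forall>b\<in>cochars l. cls l b = vec l (\<lambda>i. if i < j then 1 else 0) \<longrightarrow>
          pi_iso l (M_cell l b) (nilp_type l j)))"
proof -
  interpret odd_dimension l "2*l+1" by unfold_locales simp
  let ?F = "\<lambda>x. act (phi x) (e0 l)"
  have sub: "nilp_type l j \<subseteq> p_sq0" if "j \<le> l" for j using nilp_type_eq[OF that] by blast
  have cell: "M_cell l b = ?F ` nilp_type l j"
    if "b \<in> cochars l" "cls l b = vec l (\<lambda>i. if i < j then 1 else 0)" "j \<le> l" for b j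
    using M_cell_eq that by blast
  have union: "p_sq0 = (\<Union>j\<in>{..l}. nilp_type l j)"
  proof (intro subset_antisym subsetI)
    fix x assume x: "x \<in> p_sq0"
    obtain j where "j \<le> l" "has_rank (2*l+1) j x" using p_sq0_rank_exists[OF x] .
    then show "x \<in> (\<Union>j\<in>{..l}. nilp_type l j)" using x nilp_type_eq by blast
  qed (use sub in blast)
  have "M_small l = ?F ` p_sq0"
  proof (intro subset_antisym subsetI)
    fix c assume "c \<in> M_small l"
    then obtain b where b: "b \<in> cochars l" "small l (cls l b)" "c \<in> M_cell l b"
      by (auto simp: M_small_def)
    then obtain j where "j \<le> l" "cls l b = vec l (\<lambda>i. if i < j then 1 else 0)"
      using small_iff[OF assms] by blast
    then show "c \<in> ?F ` p_sq0" using cell b(1,3) sub by blast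
  next
    fix c assume "c \<in> ?F ` p_sq0"
    then obtain j where j: "j \<le> l" "c \<in> ?F ` nilp_type l j" unfolding union by blast
    \<comment> \<open>Each small weight must be the class of an actual cocharacter for its cell to
      occur in the union.\<close>
    obtain b where b: "b \<in> cochars l" "cls l b = vec l (\<lambda>i. if i < j then 1 else 0)"
      using exists_small_cochar[OF j(1)] by blast
    have "small l (cls l b)" using small_iff[OF assms] b(2) j(1) by blast
    then show "c \<in> M_small l" using cell[OF b j(1)] j(2) b(1) unfolding M_small_def by blast
  qed
  then have "pi_iso l (M_small l) (Np2 l)" using pi_iso_image Np2_eq by simp
  moreover have "\<exists>x\<in>Np l. nilp_type l j = K_orbit l x" if "j \<le> l" for j
    using nilp_type_orbit[OF that] by blast
  moreover have "pi_iso l (M_cell l b) (nilp_type l j)"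
    if "b \<in> cochars l" "cls l b = vec l (\<lambda>i. if i < j then 1 else 0)" "j \<le> l" for b j
    using pi_iso_image[OF sub[OF that(3)] cell[OF that]] .
  ultimately show ?thesis by blast
qed

end
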